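(* Let $\mathcal{A}$ be a trim and primitive automaton over $\mathcal{Y}\rtimes\mathbb{Z}^n$, where $\mathcal{Y}$ is a finitely presented $\mathbb{Z}[X_1^{\pm},\ldots,X_n^{\pm}]$-module. Let $\Gamma$ be a full-image, symmetric and face-accessible $\mathcal{A}$-graph. Then there exist $z_1,\ldots,z_m\in\mathbb{Z}^n$ such that the union of translations $\widehat{\Gamma}:=\bigcup_{i=1}^m \left(\Gamma+(0^s,z_i)\right)$ is an Eulerian graph.
   Context: Group: $\mathcal{Y}\rtimes\mathbb{Z}^n$ is the set of pairs $(y,a)\in\mathcal{Y}\times\mathbb{Z}^n$ with $(y,a)(y',a')=(y+\overline{X}^a\cdot y',a+a')$, where $\overline{X}^a=X_1^{a_1}\cdots X_n^{a_n}$. Automata: an automaton $\mathcal{A}$ over a group $G$ has finitely many states $q_1,\ldots,q_s$ and transitions $\delta_1,\ldots,\delta_t$; $\delta_\ell$ has origin $q_{\Omega(\ell)}$, destination $q_{\Delta(\ell)}$ and evaluation $\operatorname{ev}(\delta_\ell)\in G$; $q_1$ is both the initial and the accepting state. A path is a non-empty sequence of composable transitions, its evaluation is the product of the evaluations; it is an accepting run if it starts and ends at $q_1$; $\operatorname{ev}(\mathcal{A})$ is the set of evaluations of accepting runs. $\mathcal{A}$ is trim if every state is the origin of some transition and every transition appears in some accepting run. For $G=\mathcal{Y}\rtimes\mathbb{Z}^n$ write $\operatorname{ev}(\delta_\ell)=(y_\ell,a_\ell)$. The automaton $\mathcal{A}^{\pm}$ has the same states and transitions $\delta_1,\ldots,\delta_t,\delta_1^-,\ldots,\delta_t^-$,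 where $\delta_\ell^-$ goes from the destination of $\delta_\ell$ to its origin with evaluation $(y_\ell,a_\ell)^{-1}$. $\mathcal{A}$ is primitive if the image of $\operatorname{ev}(\mathcal{A}^{\pm})$ under the projection $\mathcal{Y}\rtimes\mathbb{Z}^n\to\mathbb{Z}^n$ is $\mathbb{Z}^n$. $\mathcal{A}$-graphs: let $b_1,\ldots,b_s$ be the standard basis of $\mathbb{Z}^s$, $\Lambda_i=\{b_i\}\times\mathbb{Z}^n\subset\mathbb{Z}^{s+n}$ and $\Lambda=\Lambda_1\sqcup\cdots\sqcup\Lambda_s$. An $\mathcal{A}$-graph is a (finite) directed multigraph $\Gamma$ whose vertex set $V(\Gamma)$ is a finite subset of $\Lambda$, each of whose edges carries a label in $\{1,\ldots,t\}$, an edge with label $\ell$ going from some vertex $(b_{\Omega(\ell)},z)$, $z\in\mathbb{Z}^n$, to $(b_{\Delta(\ell)},z+a_\ell)$. For an edge $e$, $\sigma(e)$ and $\tau(e)$ denote its source and target. $\Gamma$ is full-image if every label $\ell\in\{1,\ldots,t\}$ occurs on some edge; symmetric if in-degree equals out-degree at each vertex. $\Gamma+(0^s,z)$ is the copy of $\Gamma$ translated by $(0^s,z)$; in a union of translations, vertex sets are united and edges are counted with multiplicity. A directed graph is Eulerian if it has an Eulerian circuit (equivalently, it is symmetric and connected). Face-accessibility: let $C\subset\mathbb{R}^{s+n}$ be the convex hull of $V(\Gamma)$. A face of $C$ is the intersection of $C$ with a closed halfspace whose boundary is disjoint from the interior of $C$ (relative to its affine hull); a strict face is a face different from $\emptyset$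 and $C$. A strict face $F$ is accessible if there is an edge $e$ of $\Gamma$ with $\sigma(e)\in F$ and $\tau(e)\in C\setminus F$. $\Gamma$ is face-accessible if every strict face of $C$ is accessible. *)

theory Defs
  imports
    "HOL-Analysis.Analysis"
    "HOL-Library.Poly_Mapping"
    "HOL-Algebra.Group"
    "Graph_Theory.Graph_Theory"
    "Graph_Theory.Euler"
begin

section \<open>Modules over the Laurent polynomial ring\<close>

text \<open>
  The ring of Laurent polynomials over the integers, in variables indexed by \<open>'n\<close>, is the
  group ring of \<open>int ^ 'n\<close>, i.e. the finitely supported functions from exponent vectors to
  coefficients, with convolution as product. Modules over it are given by a type \<open>'y\<close> together
  with a scalar multiplication satisfying the library predicate \<^const>\<open>module\<close>.
\<close>

type_synonym 'n laurent = "(int ^ 'n) \<Rightarrow>\<^sub>0 int"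

definition X_pow :: "int ^ 'n::finite \<Rightarrow> 'n laurent" where
  "X_pow a = Poly_Mapping.single a 1"

text \<open>
  The module is the quotient of the free module of rank \<open>N\<close> by the submodule generated by
  the \<open>M\<close> vectors \<open>r 0, \<dots>, r (M - 1)\<close>, the classes of the unit vectors being
  \<open>y 0, \<dots>, y (N - 1)\<close>.
\<close>

definition finitely_presented :: "('r::comm_ring_1 \<Rightarrow> 'y::ab_group_add \<Rightarrow> 'y) \<Rightarrow> bool" where
  "finitely_presented smul \<longleftrightarrow>
    (\<exists>(N::nat) (y::nat \<Rightarrow> 'y) (M::nat) (r::nat \<Rightarrow> nat \<Rightarrow> 'r).
      (\<forall>v. \<exists>c. v = (\<Sum>i<N. smul (c i) (y i))) \<and>
      (\<forall>c. (\<Sum>i<N. smul (c i) (y i)) = 0 \<longleftrightarrow>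
        (\<exists>d. \<forall>i<N. c i = (\<Sum>j<M. d j * r j i))))"

definition semidirect ::
    "('n::finite laurent \<Rightarrow> 'y::ab_group_add \<Rightarrow> 'y) \<Rightarrow> ('y \<times> (int ^ 'n)) monoid" where
  "semidirect smul =
    \<lparr> carrier = UNIV,
      monoid.mult = (\<lambda>(y, a) (y', a'). (y + smul (X_pow a) y', a + a')),
      one = (0, 0) \<rparr>"

lemma group_semidirect:
  assumes "module smul"
  shows "group (semidirect smul)"
proof -
  interpret module smul by fact
  have X_add: "X_pow (a + b) = X_pow a * X_pow b" for a b :: "int ^ 'n"
    by (simp add: X_pow_def Poly_Mapping.mult_single)
  have X_zero: "X_pow (0 :: int ^ 'n) = 1"
    by (simp add: X_pow_def)
  show ?thesis
  proof (rule groupI)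
    fix x assume "x \<in> carrier (semidirect smul)"
    obtain y a where x: "x = (y, a)" by (cases x)
    show "\<exists>x'\<in>carrier (semidirect smul).
        x' \<otimes>\<^bsub>semidirect smul\<^esub> x = \<one>\<^bsub>semidirect smul\<^esub>"
      by (rule bexI[of _ "(- smul (X_pow (- a)) y, - a)"]) (simp_all add: semidirect_def x)
  qed (auto simp: semidirect_def X_add X_zero scale_right_distrib ac_simps)
qed

section \<open>Automata over a group\<close>

text \<open>States and transitions are the elements of finite types \<open>'s\<close> and \<open>'t\<close>.\<close>

record ('s, 't, 'g) automaton =
  initial :: 's
  origin :: "'t \<Rightarrow> 's"
  destination :: "'t \<Rightarrow> 's"
  ev :: "'t \<Rightarrow> 'g"

definition aut_path :: "('s, 't, 'g) automaton \<Rightarrow> 't list \<Rightarrow> bool" where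
  "aut_path A p \<longleftrightarrow> p \<noteq> [] \<and> successively (\<lambda>k l. destination A k = origin A l) p"

definition accepting_run :: "('s, 't, 'g) automaton \<Rightarrow> 't list \<Rightarrow> bool" where
  "accepting_run A p \<longleftrightarrow>
    aut_path A p \<and> origin A (hd p) = initial A \<and> destination A (last p) = initial A"

definition ev_path :: "'g monoid \<Rightarrow> ('s, 't, 'g) automaton \<Rightarrow> 't list \<Rightarrow> 'g" where
  "ev_path G A p = foldr (\<lambda>l g. ev A l \<otimes>\<^bsub>G\<^esub> g) p \<one>\<^bsub>G\<^esub>"

definition ev_automaton :: "'g monoid \<Rightarrow> ('s, 't, 'g) automaton \<Rightarrow> 'g set" where
  "ev_automaton G A = {ev_path G A p | p. accepting_run A p}"

definition trim :: "('s, 't, 'g) automaton \<Rightarrow> bool" where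
  "trim A \<longleftrightarrow>
    (\<forall>q. \<exists>l. origin A l = q) \<and> (\<forall>l. \<exists>p. accepting_run A p \<and> l \<in> set p)"

text \<open>\<open>Inl l\<close> is the original transition, \<open>Inr l\<close> the reversed one.\<close>

definition pm_automaton ::
    "'g monoid \<Rightarrow> ('s, 't, 'g) automaton \<Rightarrow> ('s, 't + 't, 'g) automaton" where
  "pm_automaton G A =
    \<lparr> initial = initial A,
      origin = case_sum (origin A) (destination A),
      destination = case_sum (destination A) (origin A),
      ev = case_sum (ev A) (\<lambda>l. inv\<^bsub>G\<^esub> (ev A l)) \<rparr>"

definition primitive ::
    "('n::finite laurent \<Rightarrow> 'y::ab_group_add \<Rightarrow> 'y) \<Rightarrow> ('s, 't, 'y \<times> (int ^ 'n)) automaton \<Rightarrow> bool"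
where
  "primitive smul A \<longleftrightarrow>
    snd ` ev_automaton (semidirect smul) (pm_automaton (semidirect smul) A) = UNIV"

section \<open>Graphs over an automaton\<close>

text \<open>
  With \<open>s = CARD('s)\<close> and \<open>n = CARD('n)\<close>, the lattice of dimension \<open>s + n\<close> is represented
  as the product of \<open>int ^ 's\<close> and \<open>int ^ 'n\<close>; the basis vector of a state \<open>q\<close> is
  \<open>axis q 1\<close>. Directed multigraphs are the library's \<^const>\<open>fin_digraph\<close>s, in which arcs have an
  identity of their own, so that parallel (even equally labelled) arcs and loops are allowed.
\<close>

type_synonym ('s, 'n) lattice = "(int ^ 's) \<times> (int ^ 'n)"

definition Lambda_at :: "'s::finite \<Rightarrow> ('s, 'n::finite) lattice set" where
  "Lambda_at q = {axis q 1} \<times> UNIV"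

definition Lambda :: "('s::finite, 'n::finite) lattice set" where
  "Lambda = (\<Union>q. Lambda_at q)"

definition automaton_graph ::
    "('s::finite, 't, 'y \<times> (int ^ 'n::finite)) automaton \<Rightarrow>
     (('s, 'n) lattice, 'e) pre_digraph \<Rightarrow> ('e \<Rightarrow> 't) \<Rightarrow> bool" where
  "automaton_graph A \<Gamma> lab \<longleftrightarrow>
    fin_digraph \<Gamma> \<and> verts \<Gamma> \<subseteq> Lambda \<and>
    (\<forall>e\<in>arcs \<Gamma>. \<exists>z.
      tail \<Gamma> e = (axis (origin A (lab e)) 1, z) \<and>
      head \<Gamma> e = (axis (destination A (lab e)) 1, z + snd (ev A (lab e))))"

definition full_image :: "('v, 'e) pre_digraph \<Rightarrow> ('e \<Rightarrow> 't) \<Rightarrow> bool" where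
  "full_image \<Gamma> lab \<longleftrightarrow> (\<forall>l. \<exists>e\<in>arcs \<Gamma>. lab e = l)"

text \<open>Not to be confused with \<^const>\<open>symmetric\<close>, which says that every arc has a reverse arc.\<close>

definition degree_symmetric :: "('v, 'e) pre_digraph \<Rightarrow> bool" where
  "degree_symmetric \<Gamma> \<longleftrightarrow> (\<forall>v\<in>verts \<Gamma>. in_degree \<Gamma> v = out_degree \<Gamma> v)"

text \<open>
  The library notion of Euler trail requires that all vertices be visited, so Eulerian graphs
  are non-empty and have no isolated vertices, unless they consist of a single vertex.
\<close>

definition eulerian :: "('v, 'e) pre_digraph \<Rightarrow> bool" where
  "eulerian \<Gamma> \<longleftrightarrow> (\<exists>u p. pre_digraph.euler_trail \<Gamma> u p u)"

text \<open>
  Arcs of a union of translations are tagged with the index of the translation they come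
  from, hence counted with multiplicity.
\<close>

definition translate ::
    "(('s::finite, 'n::finite) lattice, 'e) pre_digraph \<Rightarrow> int ^ 'n \<Rightarrow>
     (('s, 'n) lattice, 'e) pre_digraph" where
  "translate \<Gamma> z =
    \<lparr> verts = (\<lambda>v. v + (0, z)) ` verts \<Gamma>,
      arcs = arcs \<Gamma>,
      tail = (\<lambda>e. tail \<Gamma> e + (0, z)),
      head = (\<lambda>e. head \<Gamma> e + (0, z)) \<rparr>"

definition indexed_union :: "nat \<Rightarrow> (nat \<Rightarrow> ('v, 'e) pre_digraph) \<Rightarrow> ('v, nat \<times> 'e) pre_digraph"
where
  "indexed_union m \<Gamma> =
    \<lparr> verts = (\<Union>i\<in>{1..m}. verts (\<Gamma> i)),
      arcs = (SIGMA i:{1..m}. arcs (\<Gamma> i)),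
      tail = (\<lambda>(i, e). tail (\<Gamma> i) e),
      head = (\<lambda>(i, e). head (\<Gamma> i) e) \<rparr>"

section \<open>Face-accessibility\<close>

definition to_real :: "('s::finite, 'n::finite) lattice \<Rightarrow> (real ^ 's) \<times> (real ^ 'n)" where
  "to_real v = ((\<chi> i. real_of_int (fst v $ i)), (\<chi> j. real_of_int (snd v $ j)))"

text \<open>
  Here a face is a full intersection with a closed halfspace, as opposed to the library's
  \<^const>\<open>face_of\<close>. In particular the strict faces are exposed.
\<close>

definition face :: "'a::euclidean_space set \<Rightarrow> 'a set \<Rightarrow> bool" where
  "face F C \<longleftrightarrow>
    (\<exists>a b. a \<noteq> 0 \<and> {x. a \<bullet> x = b} \<inter> rel_interior C = {} \<and> F = C \<inter> {x. a \<bullet> x \<le> b})"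

definition strict_face :: "'a::euclidean_space set \<Rightarrow> 'a set \<Rightarrow> bool" where
  "strict_face F C \<longleftrightarrow> face F C \<and> F \<noteq> {} \<and> F \<noteq> C"

definition face_accessible ::
    "(('s::finite, 'n::finite) lattice, 'e) pre_digraph \<Rightarrow> bool" where
  "face_accessible \<Gamma> \<longleftrightarrow>
    (let C = convex hull (to_real ` verts \<Gamma>) in
      \<forall>F. strict_face F C \<longrightarrow>
        (\<exists>e\<in>arcs \<Gamma>. to_real (tail \<Gamma> e) \<in> F \<and> to_real (head \<Gamma> e) \<in> C - F))"

end

theory Submission
  imports Defs
begin

text \<open>
  A vertex of \<open>\<Lambda>\<close> is a pair \<open>(q, x)\<close> of a state and a position. Translates of a graph whose
  degrees balance again have balanced degrees, so only (weak) connectedness of the union is at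
  stake. The translations are taken to be the lattice points of \<open>r K\<close> for large \<open>r\<close>, where
  \<open>K\<close> is the zonotope generated by the standard basis and by all differences of positions of
  vertices of \<open>\<Gamma>\<close>.

  The translates by all of \<open>\<int>\<^sup>n\<close> together are connected: every transition occurs at every
  position, and trimness and primitivity supply the paths (\<open>linked_everywhere\<close>). By periodicity
  finitely many translations suffice for the paths between neighbouring positions, hence all
  vertices that belong to translates deep inside \<open>r K\<close> are linked with each other. It
  remains to link a translate near the boundary to a deep one.

  Consider first a half-space with inner normal \<open>u\<close>. A vertex \<open>(q, x)\<close> of the translate by \<open>z\<close>
  is also the vertex \<open>(q, x')\<close> of the translate by \<open>z + (x - x')\<close>; if \<open>x'\<close> is a position of
  \<open>q\<close> at which \<open>u\<close> is lowest, then the new translation is at least as far inside as the old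
  one, so all edges at lowest positions can be used. Follow those that stay among lowest
  positions, and let \<open>Q\<close> be the set of states reached from \<open>q\<close>. For a suitable \<open>\<beta>\<close> the
  functional \<open>(\<beta>, u)\<close> is minimal over the hull exactly on the face spanned by the lowest
  positions of the states in \<open>Q\<close>, and face-accessibility provides an edge that leaves this face
  and therefore, by the choice of \<open>Q\<close>, the set of lowest positions (\<open>leave_lowest\<close>). At its
  head, switching to a lowest position makes \<open>z\<close> strictly better. The face cannot be everything, since then \<open>u\<close> would
  extend to a potential that is constant along all paths (\<open>no_affine_potential\<close>).

  A point of \<open>r K\<close> may be close to several facets at once, with inner normals \<open>u\<^sub>h\<close>, and here it
  matters that \<open>K\<close> is a zonotope: a generator \<open>d\<close> with \<open>u\<^sub>h \<bullet> d < 0 < u\<^sub>k \<bullet> d\<close> keeps the facets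
  \<open>h\<close> and \<open>k\<close> far apart (\<open>zonotope_opposed_facets\<close>). So for the sum \<open>u\<close> of the normals of the
  close facets, a change of position that does not lower \<open>u\<close> lowers none of the summands, and
  the argument for one half-space applies (\<open>exists_ascent\<close>). A ball would
  not do: if an isolated vertex \<open>(q, x)\<close> of \<open>\<Gamma>\<close> is the midpoint of the only two other vertices of
  state \<open>q\<close>, then for a translation on the sphere both alternatives may fall outside, which leaves
  the vertex isolated in the union.

  The walk inwards ends because the sum of \<open>exp (- s)\<close> over the slacks \<open>s\<close> of \<open>z\<close> at the facets
  decreases, provided that the close facets are separated from the others by a gap; such a gap
  exists by the pigeonhole principle (\<open>slack_gap\<close>, \<open>exp_potential_decreases\<close>).
\<close>

section \<open>Zonotopes\<close>

definition zonotope :: "'a::euclidean_space set \<Rightarrow> 'a set" where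
  "zonotope D = {(\<Sum>d\<in>D. c d *\<^sub>R d) | c. \<forall>d\<in>D. \<bar>c d\<bar> \<le> 1}"

text \<open>Adding a generator is a Minkowski sum with a segment, a linear image of a product.\<close>
lemma polytope_zonotope:
  assumes "finite D"
  shows "polytope (zonotope D)"
  using assms
proof induction
  case empty
  then show ?case by (simp add: zonotope_def polytope_def) (metis convex_hull_singleton finite.emptyI finite_insert)
next
  case (insert d D)
  have seg: "polytope (closed_segment (- d) d)"
    unfolding segment_convex_hull by (rule polytope_convex_hull) simp
  have in_seg: "x \<in> closed_segment (- d) d \<longleftrightarrow> (\<exists>t. \<bar>t\<bar> \<le> 1 \<and> x = t *\<^sub>R d)" for x
  proof
    assume "x \<in> closed_segment (- d) d"
    then obtain s where "0 \<le> s" "s \<le> 1" "x = (1 - s) *\<^sub>R - d + s *\<^sub>R d"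
      by (auto simp: in_segment)
    then show "\<exists>t. \<bar>t\<bar> \<le> 1 \<and> x = t *\<^sub>R d"
      by (intro exI[of _ "2 * s - 1"]) (auto simp: algebra_simps scaleR_2 simp flip: scaleR_scaleR)
  next
    assume "\<exists>t. \<bar>t\<bar> \<le> 1 \<and> x = t *\<^sub>R d"
    then obtain t where t: "\<bar>t\<bar> \<le> 1" "x = t *\<^sub>R d" by blast
    have "(1 - (t + 1) / 2) *\<^sub>R - d + ((t + 1) / 2) *\<^sub>R d = ((t + 1) / 2 - (1 - (t + 1) / 2)) *\<^sub>R d"
      by (simp only: scaleR_left_diff_distrib) simp
    also have "\<dots> = t *\<^sub>R d"
      by (simp add: field_simps)
    finally show "x \<in> closed_segment (- d) d"
      using t unfolding in_segment by (intro exI[of _ "(t + 1) / 2"]) auto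
  qed
  have "zonotope (insert d D) = (\<lambda>(x, y). x + y) ` (closed_segment (- d) d \<times> zonotope D)" (is "?L = ?R")
  proof (intro subset_antisym subsetI)
    fix x assume "x \<in> ?L"
    then obtain c where c: "\<forall>e\<in>insert d D. \<bar>c e\<bar> \<le> 1" "x = (\<Sum>e\<in>insert d D. c e *\<^sub>R e)"
      by (auto simp: zonotope_def)
    have "x = c d *\<^sub>R d + (\<Sum>e\<in>D. c e *\<^sub>R e)"
      using insert c by simp
    moreover have "c d *\<^sub>R d \<in> closed_segment (- d) d"
      using c by (auto simp: in_seg)
    moreover have "(\<Sum>e\<in>D. c e *\<^sub>R e) \<in> zonotope D"
      using c by (auto simp: zonotope_def)
    ultimately show "x \<in> ?R" by force
  next
    fix x assume "x \<in> ?R"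
    then obtain t c where tc: "\<bar>t\<bar> \<le> 1" "\<forall>e\<in>D. \<bar>c e\<bar> \<le> 1" "x = t *\<^sub>R d + (\<Sum>e\<in>D. c e *\<^sub>R e)"
      by (auto simp: zonotope_def in_seg)
    have "x = (\<Sum>e\<in>insert d D. (c(d := t)) e *\<^sub>R e)"
      using insert tc by (simp cong: sum.cong) (intro sum.cong, auto)
    moreover have "\<forall>e\<in>insert d D. \<bar>(c(d := t)) e\<bar> \<le> 1"
      using tc by auto
    ultimately show "x \<in> ?L" unfolding zonotope_def by blast
  qed
  moreover have "linear (\<lambda>(x, y). x + y :: 'a)"
    by (rule linearI) (auto simp: algebra_simps)
  ultimately show ?case
    using polytope_linear_image polytope_Times seg insert.IH by metis
qed

text \<open>
  The normals point inwards, so that \<open>b + u \<bullet> x\<close> measures how far \<open>x\<close> is inside. The lower bound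
  on \<open>b\<close> is the support function of the zonotope at \<open>- u\<close>.
\<close>
lemma zonotope_halfspaces:
  fixes D :: "'a::euclidean_space set"
  assumes "finite D" and span: "\<And>u. u \<noteq> 0 \<Longrightarrow> \<exists>d\<in>D. u \<bullet> d \<noteq> 0"
  obtains H :: "('a \<times> real) set"
    where "finite H" "zonotope D = {x. \<forall>(u, b)\<in>H. 0 \<le> b + u \<bullet> x}"
      "\<And>u b. (u, b) \<in> H \<Longrightarrow> u \<noteq> 0 \<and> 0 < b \<and> (\<Sum>d\<in>D. \<bar>u \<bullet> d\<bar>) \<le> b"
proof -
  obtain F where F: "finite F" "zonotope D = \<Inter> F"
    "\<forall>h\<in>F. \<exists>a b. a \<noteq> 0 \<and> h = {x. a \<bullet> x \<le> b}"
    using polytope_imp_polyhedron[OF polytope_zonotope[OF assms(1)]] unfolding polyhedron_def by blast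
  then obtain a b where ab: "\<And>h. h \<in> F \<Longrightarrow> a h \<noteq> 0 \<and> h = {x. a h \<bullet> x \<le> b h}"
    by metis
  define H where "H = (\<lambda>h. (- a h, b h)) ` F"
  have Z: "zonotope D = {x. \<forall>(u, b)\<in>H. 0 \<le> b + u \<bullet> x}"
  proof -
    have "x \<in> h \<longleftrightarrow> 0 \<le> b h - a h \<bullet> x" if "h \<in> F" for x h
      using ab[OF that] by (metis diff_ge_0_iff_ge mem_Collect_eq)
    then show ?thesis unfolding F(2) by (auto simp: H_def)
  qed
  have "u \<noteq> 0 \<and> 0 < c \<and> (\<Sum>d\<in>D. \<bar>u \<bullet> d\<bar>) \<le> c" if uc: "(u, c) \<in> H" for u c
  proof -
    have u: "u \<noteq> 0" using uc ab by (auto simp: H_def)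
    \<comment> \<open>the point of the zonotope at which \<open>u\<close> is lowest\<close>
    define x where "x = (\<Sum>d\<in>D. (- sgn (u \<bullet> d)) *\<^sub>R d)"
    have "x \<in> zonotope D"
      unfolding zonotope_def x_def by (intro CollectI exI[of _ "\<lambda>d. - sgn (u \<bullet> d)"]) (auto simp: sgn_if)
    then have "0 \<le> c + u \<bullet> x" using uc Z by auto
    also have "u \<bullet> x = - (\<Sum>d\<in>D. \<bar>u \<bullet> d\<bar>)"
      by (simp add: x_def inner_sum_right abs_sgn mult.commute sum_negf)
    finally have le: "(\<Sum>d\<in>D. \<bar>u \<bullet> d\<bar>) \<le> c" by simp
    moreover obtain d where "d \<in> D" "u \<bullet> d \<noteq> 0" using span[OF u] by blast
    then have "0 < (\<Sum>d\<in>D. \<bar>u \<bullet> d\<bar>)"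
      using assms(1) by (intro sum_pos2[of _ d]) auto
    ultimately show ?thesis using u by auto
  qed
  moreover have "finite H" using F by (simp add: H_def)
  ultimately show thesis using that Z by blast
qed

text \<open>
  At \<open>x = (\<Sum>e\<in>D. c e *\<^sub>R e)\<close>, \<open>b + u \<bullet> x\<close> is at least the sum of the nonnegative contributions \<open>\<bar>u \<bullet> e\<bar> + c e * (u \<bullet> e)\<close> of the
  generators. If \<open>u\<close> and \<open>u'\<close> disagree about the sign at \<open>d\<close>, no coefficient of \<open>d\<close> makes both
  contributions small.
\<close>
lemma zonotope_opposed_facets:
  fixes D :: "'a::euclidean_space set"
  assumes D: "finite D" "d \<in> D" and x: "x \<in> zonotope D"
    and b: "(\<Sum>d\<in>D. \<bar>u \<bullet> d\<bar>) \<le> b" "(\<Sum>d\<in>D. \<bar>u' \<bullet> d\<bar>) \<le> b'"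
    and ud: "u \<bullet> d < 0" "0 < u' \<bullet> d"
  shows "2 * min \<bar>u \<bullet> d\<bar> \<bar>u' \<bullet> d\<bar> \<le> (b + u \<bullet> x) + (b' + u' \<bullet> x)"
proof -
  obtain c where c: "\<forall>e\<in>D. \<bar>c e\<bar> \<le> 1" "x = (\<Sum>e\<in>D. c e *\<^sub>R e)"
    using x by (auto simp: zonotope_def)
  let ?g = "\<lambda>e. \<bar>u \<bullet> e\<bar> + \<bar>u' \<bullet> e\<bar> + c e * (u \<bullet> e + u' \<bullet> e)"
  have *: "\<bar>u \<bullet> e\<bar> + \<bar>u' \<bullet> e\<bar> - \<bar>u \<bullet> e + u' \<bullet> e\<bar> \<le> ?g e" if "e \<in> D" for e
  proof -
    have "\<bar>c e * (u \<bullet> e + u' \<bullet> e)\<bar> \<le> \<bar>u \<bullet> e + u' \<bullet> e\<bar>"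
      using c that by (simp add: abs_mult mult_left_le_one_le)
    then show ?thesis by linarith
  qed
  have "2 * min \<bar>u \<bullet> d\<bar> \<bar>u' \<bullet> d\<bar> \<le> ?g d"
    using *[OF D(2)] ud by linarith
  also have "\<dots> \<le> (\<Sum>e\<in>D. ?g e)"
  proof (rule member_le_sum)
    fix e assume "e \<in> D - {d}"
    then show "0 \<le> ?g e" using *[of e] by simp
  qed (use D in auto)
  also have "\<dots> = (\<Sum>e\<in>D. \<bar>u \<bullet> e\<bar>) + (\<Sum>e\<in>D. \<bar>u' \<bullet> e\<bar>) + (u \<bullet> x + u' \<bullet> x)"
    by (simp add: c sum.distrib inner_sum_right algebra_simps)
  finally show ?thesis using b by linarith
qed

section \<open>Integer vectors as real vectors\<close>

definition real_vec :: "int ^ 'n::finite \<Rightarrow> real ^ 'n" where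
  "real_vec z = (\<chi> j. real_of_int (z $ j))"

lemma real_vec_nth [simp]: "real_vec z $ j = real_of_int (z $ j)"
  by (simp add: real_vec_def)

lemma real_vec_simps [simp]:
  "real_vec 0 = 0"
  "real_vec (x + y) = real_vec x + real_vec y"
  "real_vec (x - y) = real_vec x - real_vec y"
  "real_vec (axis j 1) = axis j 1"
  by (simp_all add: vec_eq_iff axis_def)

lemma finite_vec_range:
  assumes "finite (A :: int set)"
  shows "finite {z :: int ^ 'n::finite. \<forall>j. z $ j \<in> A}"
proof (rule finite_imageD)
  have "vec_nth ` {z :: int ^ 'n. \<forall>j. z $ j \<in> A} \<subseteq> PiE UNIV (\<lambda>_. A)"
    by (auto simp: PiE_def)
  then show "finite (vec_nth ` {z :: int ^ 'n. \<forall>j. z $ j \<in> A})"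
    using finite_PiE[of UNIV "\<lambda>_. A"] assms finite_subset by (metis finite_class.finite_UNIV)
  show "inj_on vec_nth {z :: int ^ 'n. \<forall>j. z $ j \<in> A}"
    by (rule inj_onI) (simp add: vec_eq_iff)
qed

lemma finite_bounded_lattice:
  assumes "bounded (real_vec ` Z)"
  shows "finite (Z :: (int ^ 'n::finite) set)"
proof -
  obtain B where B: "\<And>z. z \<in> Z \<Longrightarrow> norm (real_vec z) \<le> B"
    using assms by (auto simp: bounded_iff)
  have "z $ j \<in> {- \<lceil>B\<rceil>..\<lceil>B\<rceil>}" if "z \<in> Z" for z j
    using component_le_norm_cart[of "real_vec z" j] B[OF that] by simp linarith
  then have "Z \<subseteq> {z. \<forall>j. z $ j \<in> {- \<lceil>B\<rceil>..\<lceil>B\<rceil>}}" by blast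
  then show ?thesis
    using finite_vec_range finite_subset finite_atLeastAtMost_int by blast
qed

text \<open>The integer points obtained by rounding down the subdivision of the segment from \<open>0\<close> to \<open>z\<close>
  into \<open>N\<close> equal parts.\<close>
definition lattice_segment :: "int ^ 'n::finite \<Rightarrow> nat \<Rightarrow> nat \<Rightarrow> int ^ 'n" where
  "lattice_segment z N k = (\<chi> j. (int k * z $ j) div int N)"

lemma lattice_segment_ends:
  "lattice_segment z N 0 = 0" "0 < N \<Longrightarrow> lattice_segment z N N = z"
  by (simp_all add: lattice_segment_def vec_eq_iff)

lemma lattice_segment_step:
  assumes "0 < N" "\<And>j. \<bar>z $ j\<bar> \<le> int N"
  shows "lattice_segment z N (Suc k) $ j - lattice_segment z N k $ j \<in> {- 1, 0, 1}"
proof -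
  let ?a = "int k * z $ j" and ?b = "int (Suc k) * z $ j"
  have "?b = ?a + z $ j" by (simp add: algebra_simps)
  then have "?a - int N \<le> ?b" "?b \<le> ?a + int N" using assms(2)[of j] by linarith+
  then have "(?a - int N) div int N \<le> ?b div int N" "?b div int N \<le> (?a + int N) div int N"
    using assms(1) by (simp_all only: zdiv_mono1 of_nat_0_less_iff)
  moreover have "(?a - int N) div int N = ?a div int N - 1" "(?a + int N) div int N = ?a div int N + 1"
    using assms(1) div_add_self2[of "int N" ?a] div_add_self2[of "int N" "?a - int N"] by auto
  ultimately have "-1 \<le> ?b div int N - ?a div int N" "?b div int N - ?a div int N \<le> 1" by auto
  then show ?thesis unfolding lattice_segment_def vec_lambda_beta by auto
qed

lemma lattice_segment_inner:
  assumes "0 < N"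
  shows "\<bar>u \<bullet> real_vec (lattice_segment z N k) - real k / real N * (u \<bullet> real_vec z)\<bar> \<le> (\<Sum>j\<in>UNIV. \<bar>u $ j\<bar>)"
proof -
  have "\<bar>u $ j * (real_of_int ((int k * z $ j) div int N) - real k / real N * z $ j)\<bar> \<le> \<bar>u $ j\<bar>" for j
  proof -
    have "(int k * z $ j) div int N = \<lfloor>real k / real N * z $ j\<rfloor>"
      using floor_divide_of_int_eq[of "int k * z $ j" "int N", where 'a = real] by simp
    then have "\<bar>real_of_int ((int k * z $ j) div int N) - real k / real N * z $ j\<bar> \<le> 1"
      by linarith
    then show ?thesis by (simp add: abs_mult mult_left_le)
  qed
  then have "\<bar>\<Sum>j\<in>UNIV. u $ j * (real_of_int ((int k * z $ j) div int N) - real k / real N * z $ j)\<bar> \<le> (\<Sum>j\<in>UNIV. \<bar>u $ j\<bar>)"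
    by (intro order_trans[OF sum_abs] sum_mono)
  then show ?thesis
    by (simp add: inner_vec_def lattice_segment_def sum_subtractf sum_distrib_left algebra_simps)
qed

section \<open>Linking vertices through translated edges\<close>

fun shift :: "'s \<times> 'g::ab_group_add \<Rightarrow> 'g \<Rightarrow> 's \<times> 'g" where
  "shift (q, x) z = (q, x + z)"

lemma fst_shift [simp]: "fst (shift v z) = fst v"
  and snd_shift [simp]: "snd (shift v z) = snd v + z"
  and shift_0 [simp]: "shift v 0 = v"
  and shift_shift [simp]: "shift (shift v z) z' = shift v (z + z')"
  by (cases v; simp add: add.assoc)+

text \<open>
  Weak connectedness in the union of the translates of the edge set \<open>E\<close> by the elements of \<open>Z\<close>:
  edges may be traversed in both directions.
\<close>
definition linked :: "(('s \<times> 'g::ab_group_add) \<times> 's \<times> 'g) set \<Rightarrow> 'g set \<Rightarrow> 's \<times> 'g \<Rightarrow> 's \<times> 'g \<Rightarrow> bool"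
where
  "linked E Z = (\<lambda>v w. \<exists>(x, y)\<in>E. \<exists>z\<in>Z.
     v = shift x z \<and> w = shift y z \<or> v = shift y z \<and> w = shift x z)\<^sup>*\<^sup>*"

lemma linked_refl [simp]: "linked E Z v v"
  by (simp add: linked_def)

lemma linked_trans: "linked E Z u v \<Longrightarrow> linked E Z v w \<Longrightarrow> linked E Z u w"
  unfolding linked_def by (rule rtranclp_trans)

lemma linked_sym: "linked E Z v w \<Longrightarrow> linked E Z w v"
  unfolding linked_def
  by (rule sympD[OF symp_rtranclp]) (auto simp: symp_def)

lemma linked_edge: "(v, w) \<in> E \<Longrightarrow> z \<in> Z \<Longrightarrow> linked E Z (shift v z) (shift w z)"
  unfolding linked_def by (rule r_into_rtranclp) blast

lemma linked_induct [consumes 1, case_names refl forward backward]: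
  assumes "linked E Z v w"
    and "P v"
    and "\<And>x y z. linked E Z v (shift x z) \<Longrightarrow> P (shift x z) \<Longrightarrow> (x, y) \<in> E \<Longrightarrow> z \<in> Z \<Longrightarrow> P (shift y z)"
    and "\<And>x y z. linked E Z v (shift y z) \<Longrightarrow> P (shift y z) \<Longrightarrow> (x, y) \<in> E \<Longrightarrow> z \<in> Z \<Longrightarrow> P (shift x z)"
  shows "P w"
  using assms(1) unfolding linked_def
proof (induction rule: rtranclp_induct)
  case (step y z)
  then show ?case using assms(3,4) unfolding linked_def by blast
qed (rule assms(2))

lemma linked_shift:
  assumes "linked E Z v w" and "\<And>z. z \<in> Z \<Longrightarrow> z + y \<in> Z'"
  shows "linked E Z' (shift v y) (shift w y)"
  using assms(1)
proof (induction rule: linked_induct)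
  case (forward a b z)
  then show ?case using linked_edge[of a b E "z + y" Z'] assms(2) linked_trans by fastforce
next
  case (backward a b z)
  then show ?case using linked_edge[of a b E "z + y" Z', THEN linked_sym] assms(2) linked_trans by fastforce
qed simp

lemma linked_mono: "linked E Z v w \<Longrightarrow> Z \<subseteq> Z' \<Longrightarrow> linked E Z' v w"
  using linked_shift[of E Z v w 0 Z'] by auto

lemma linked_finite_support:
  assumes "linked E Z v w"
  obtains W where "finite W" "W \<subseteq> Z" "linked E W v w"
proof -
  have "\<exists>W. finite W \<and> W \<subseteq> Z \<and> linked E W v w"
    using assms
  proof (induction rule: linked_induct)
    case refl
    show ?case by (intro exI[of _ "{}"]) simp
  next
    case (forward a b z)
    then obtain W where W: "finite W" "W \<subseteq> Z" "linked E W v (shift a z)" by blast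
    have "linked E (insert z W) v (shift b z)"
      using linked_mono[OF W(3)] linked_edge[OF \<open>(a, b) \<in> E\<close>, of z "insert z W"] by (blast intro: linked_trans)
    then show ?case using W forward by (intro exI[of _ "insert z W"]) auto
  next
    case (backward a b z)
    then obtain W where W: "finite W" "W \<subseteq> Z" "linked E W v (shift b z)" by blast
    have "linked E (insert z W) v (shift a z)"
      using linked_mono[OF W(3)] linked_edge[OF \<open>(a, b) \<in> E\<close>, of z "insert z W", THEN linked_sym]
      by (blast intro: linked_trans)
    then show ?case using W backward by (intro exI[of _ "insert z W"]) auto
  qed
  then show thesis using that by blast
qed

section \<open>Moving inwards from a half-space boundary\<close>

definition affine_fun :: "('s \<Rightarrow> real) \<Rightarrow> real ^ 'n \<Rightarrow> 's \<times> (int ^ 'n::finite) \<Rightarrow> real" where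
  "affine_fun \<beta> u v = \<beta> (fst v) + u \<bullet> real_vec (snd v)"

text \<open>
  The properties of \<open>\<Gamma>\<close> on which connectedness rests. The assumption \<open>exits\<close> is
  face-accessibility with faces described by the functionals that expose them, and
  \<open>linked_UNIV\<close> says that the translates by all lattice vectors form a connected graph.
\<close>
locale periodic_graph =
  fixes V :: "('s::finite \<times> (int ^ 'n::finite)) set"
    and E :: "(('s \<times> (int ^ 'n)) \<times> ('s \<times> (int ^ 'n))) set"
  assumes finite_V: "finite V"
    and edges: "E \<subseteq> V \<times> V"
    and states: "\<exists>x. (q, x) \<in> V"
    and exits: "\<lbrakk>\<forall>v\<in>V. m \<le> affine_fun \<beta> u v; \<exists>v\<in>V. affine_fun \<beta> u v = m; \<exists>v\<in>V. m < affine_fun \<beta> u v\<rbrakk>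
      \<Longrightarrow> \<exists>(v, w)\<in>E. affine_fun \<beta> u v = m \<and> m < affine_fun \<beta> u w"
    and linked_UNIV: "linked E UNIV v w"
begin

text \<open>
  A functional that is constant along every edge changes by \<open>u \<bullet> z\<close> under translation by \<open>z\<close>, but
  \<open>(q, 0)\<close> is linked to all of its translates.
\<close>
lemma no_affine_potential:
  assumes "\<And>v w. (v, w) \<in> E \<Longrightarrow> affine_fun \<beta> u v = affine_fun \<beta> u w"
  shows "u = 0"
proof -
  have shift: "affine_fun \<beta> u (shift v z) = affine_fun \<beta> u v + u \<bullet> real_vec z" for v z
    by (simp add: affine_fun_def inner_add_right)
  have inv: "affine_fun \<beta> u w = affine_fun \<beta> u v" for v w
    using linked_UNIV[of v w]
    by (induction rule: linked_induct) (auto simp: shift dest: assms)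
  have "u $ j = 0" for j
    using inv[of "(undefined, axis j 1)" "(undefined, 0)"]
    by (simp add: affine_fun_def cart_eq_inner_axis)
  then show ?thesis by (simp add: vec_eq_iff)
qed

definition state_min :: "real ^ 'n \<Rightarrow> 's \<Rightarrow> real" where
  "state_min u q = Min ((\<lambda>x. u \<bullet> real_vec x) ` {x. (q, x) \<in> V})"

definition lowest :: "real ^ 'n \<Rightarrow> ('s \<times> (int ^ 'n)) set" where
  "lowest u = {(q, x) \<in> V. u \<bullet> real_vec x = state_min u q}"

lemma finite_fibre: "finite {x. (q, x) \<in> V}"
  using finite_imageI[OF finite_V, of snd] by (rule rev_finite_subset) force

lemma state_min_le: "(q, x) \<in> V \<Longrightarrow> state_min u q \<le> u \<bullet> real_vec x"
  unfolding state_min_def using finite_fibre by (intro Min_le) auto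

lemma lowest_subset: "lowest u \<subseteq> V"
  by (auto simp: lowest_def)

lemma lowest_ex:
  obtains x where "(q, x) \<in> lowest u"
proof -
  have "state_min u q \<in> (\<lambda>x. u \<bullet> real_vec x) ` {x. (q, x) \<in> V}"
    unfolding state_min_def using finite_fibre states by (intro Min_in) auto
  then show thesis using that by (auto simp: lowest_def)
qed

lemma lowest_le: "(q, x) \<in> lowest u \<Longrightarrow> (q, x') \<in> V \<Longrightarrow> u \<bullet> real_vec x \<le> u \<bullet> real_vec x'"
  using state_min_le by (auto simp: lowest_def)

lemma lowest_less:
  "(q, x) \<in> lowest u \<Longrightarrow> (q, x') \<in> V \<Longrightarrow> (q, x') \<notin> lowest u \<Longrightarrow> u \<bullet> real_vec x < u \<bullet> real_vec x'"
  using state_min_le[of q x' u] by (auto simp: lowest_def)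

text \<open>The passage between states along an edge within the lowest positions; the position at
  which a state is entered need not be the one from which it is left.\<close>
definition lowest_step :: "real ^ 'n \<Rightarrow> 's \<Rightarrow> 's \<Rightarrow> bool" where
  "lowest_step u q q' \<longleftrightarrow> (\<exists>x x'. ((q, x), (q', x')) \<in> E \<and> (q, x) \<in> lowest u \<and> (q', x') \<in> lowest u)"

text \<open>
  Otherwise the lowest positions of the states \<open>Q\<close> reachable from \<open>q\<close> would form a face that no
  edge leaves, or be all vertices, and then \<open>u\<close> would define a potential.
\<close>
lemma leave_lowest:
  assumes "u \<noteq> 0"
  obtains q' x w where "(lowest_step u)\<^sup>*\<^sup>* q q'" "(q', x) \<in> lowest u" "((q', x), w) \<in> E" "w \<notin> lowest u"
proof (rule ccontr)
  note leave = that
  assume "\<not> thesis"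
  then have stuck: "w \<in> lowest u"
    if "(lowest_step u)\<^sup>*\<^sup>* q q'" "(q', x) \<in> lowest u" "((q', x), w) \<in> E" for q' x w
    using that leave by blast
  define Q where "Q = {q'. (lowest_step u)\<^sup>*\<^sup>* q q'}"
  have stay: "w \<in> lowest u \<and> fst w \<in> Q" if "(v, w) \<in> E" "v \<in> lowest u" "fst v \<in> Q" for v w
  proof -
    obtain p x p' x' where v: "v = (p, x)" "w = (p', x')" by (cases v, cases w)
    have "w \<in> lowest u" using stuck that v unfolding Q_def by auto
    moreover have "p' \<in> Q"
      using calculation that v unfolding Q_def lowest_step_def
      by (auto intro!: rtranclp.rtrancl_into_rtrancl[of _ q p] simp: lowest_step_def)
    ultimately show ?thesis using v by simp
  qed
  \<comment> \<open>subtracting the minimum puts the lowest positions of all states at height 0; raising the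
     states outside \<open>Q\<close> by 1 keeps them off the face\<close>
  define \<beta> where "\<beta> p = (if p \<in> Q then 0 else 1) - state_min u p" for p
  have nonneg: "0 \<le> affine_fun \<beta> u v" if "v \<in> V" for v
    using state_min_le[of "fst v" "snd v" u] that by (auto simp: affine_fun_def \<beta>_def)
  have zero: "affine_fun \<beta> u v = 0 \<longleftrightarrow> v \<in> lowest u \<and> fst v \<in> Q" if "v \<in> V" for v
    using state_min_le[of "fst v" "snd v" u] that
    by (cases v) (auto simp: affine_fun_def \<beta>_def lowest_def)
  obtain x0 where x0: "(q, x0) \<in> lowest u" by (rule lowest_ex)
  have "q \<in> Q" by (simp add: Q_def)
  then have ex: "\<exists>v\<in>V. affine_fun \<beta> u v = 0" using zero x0 lowest_subset by fastforce
  show False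
  proof (cases "\<exists>v\<in>V. 0 < affine_fun \<beta> u v")
    case True
    then obtain v w where vw: "(v, w) \<in> E" "affine_fun \<beta> u v = 0" "0 < affine_fun \<beta> u w"
      using exits[of 0 \<beta> u] nonneg ex by auto
    then have "v \<in> V" "w \<in> V" using edges by auto
    then show False using vw stay zero by fastforce
  next
    case False
    then have "affine_fun \<beta> u v = 0" if "v \<in> V" for v
      using False nonneg[OF that] that by (metis order_le_less)
    then show False using no_affine_potential[of \<beta> u] edges assms by fastforce
  qed
qed

text \<open>
  The set \<open>C\<close> stands for the translations that are known to stay admissible; the last assumption
  says that switching a vertex to a position where \<open>u\<close> is no higher is such a translation. The
  walk is followed backwards, from the leaving edge provided by \<open>leave_lowest\<close> to \<open>q\<close>. A finite
  set \<open>W\<close> of translations serves all vertices of state \<open>q\<close>, which by periodicity makes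
  the ascent uniform.
\<close>
lemma exists_ascent:
  assumes "u \<noteq> 0" and add: "\<And>y y'. y \<in> C \<Longrightarrow> y' \<in> C \<Longrightarrow> y + y' \<in> C"
    and diff: "\<And>q x x'. (q, x) \<in> V \<Longrightarrow> (q, x') \<in> V \<Longrightarrow> u \<bullet> real_vec x' \<le> u \<bullet> real_vec x \<Longrightarrow> x - x' \<in> C"
  shows "\<exists>W \<subseteq> C. finite W \<and> (\<forall>x. (q, x) \<in> V \<longrightarrow>
    (\<exists>y\<in>W. \<exists>v'\<in>V. 0 < u \<bullet> real_vec y \<and> linked E W (q, x) (shift v' y)))"
proof -
  define D where "D = {x - x' | p x x'. (p, x) \<in> V \<and> (p, x') \<in> V \<and> u \<bullet> real_vec x' \<le> u \<bullet> real_vec x}"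
  have DI: "x - x' \<in> D" if "(p, x) \<in> V" "(p, x') \<in> V" "u \<bullet> real_vec x' \<le> u \<bullet> real_vec x" for p x x'
    using that unfolding D_def by blast
  have "D \<subseteq> (\<lambda>(v, w). snd v - snd w) ` (V \<times> V)" by (auto simp: D_def) force
  then have "finite D" using finite_V by (meson finite_SigmaI finite_imageI finite_subset)
  have DC: "D \<subseteq> C" using diff by (auto simp: D_def)
  have swap: "(p, x) = shift (p, x') (x - x')" for p :: 's and x x' :: "int ^ 'n" by simp
  obtain q' x0 w where q': "(lowest_step u)\<^sup>*\<^sup>* q q'" "(q', x0) \<in> lowest u" "((q', x0), w) \<in> E" "w \<notin> lowest u"
    using leave_lowest[OF assms(1)] .
  from q'(1) show ?thesis
  proof (induction rule: converse_rtranclp_induct)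
    case base
    obtain p y where w: "w = (p, y)" by (cases w)
    have wV: "(p, y) \<in> V" using q' w edges by auto
    obtain y' where y': "(p, y') \<in> lowest u" by (rule lowest_ex)
    have less: "u \<bullet> real_vec y' < u \<bullet> real_vec y"
      using lowest_less[OF y' wV] q'(4) w by simp
    have e: "y - y' \<in> D" "0 < u \<bullet> real_vec (y - y')"
      using less y' wV lowest_subset[of u] DI[of p y y'] by (auto simp: inner_diff_right)
    \<comment> \<open>one switch to reach the tail of the leaving edge, one switch at its head\<close>
    let ?W = "D \<union> (\<lambda>(d, e). d + e) ` (D \<times> D)"
    have "\<exists>y\<in>?W. \<exists>v'\<in>V. 0 < u \<bullet> real_vec y \<and> linked E ?W (q', x) (shift v' y)" if x: "(q', x) \<in> V" for x
    proof -
      have d: "x - x0 \<in> D" "0 \<le> u \<bullet> real_vec (x - x0)"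
        using lowest_le[OF q'(2) x] x q'(2) lowest_subset[of u] DI[of q' x x0] by (auto simp: inner_diff_right)
      have "linked E ?W (q', x) (shift (p, y) (x - x0))"
        using linked_edge[OF q'(3), of "x - x0" ?W] d w by (metis UnI1 swap)
      also have "shift (p, y) (x - x0) = shift (p, y') ((x - x0) + (y - y'))"
        by simp
      finally have "linked E ?W (q', x) (shift (p, y') ((x - x0) + (y - y')))" .
      moreover have "(x - x0) + (y - y') \<in> ?W" using d e by force
      moreover have "0 < u \<bullet> real_vec ((x - x0) + (y - y'))"
        using d e by (simp add: inner_add_right inner_diff_right)
      ultimately show ?thesis using y' lowest_subset by blast
    qed
    moreover have "finite ?W" using \<open>finite D\<close> by simp
    moreover have "?W \<subseteq> C" using DC by (auto intro!: add)
    ultimately show ?case by blast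
  next
    case (step q q'')
    then obtain W where W: "W \<subseteq> C" "finite W"
      "\<And>x. (q'', x) \<in> V \<Longrightarrow> \<exists>y\<in>W. \<exists>v'\<in>V. 0 < u \<bullet> real_vec y \<and> linked E W (q'', x) (shift v' y)"
      by blast
    obtain x1 x2 where x12: "((q, x1), (q'', x2)) \<in> E" "(q, x1) \<in> lowest u" "(q'', x2) \<in> lowest u"
      using step by (auto simp: lowest_step_def)
    obtain y v' where y: "y \<in> W" "v' \<in> V" "0 < u \<bullet> real_vec y" "linked E W (q'', x2) (shift v' y)"
      using W(3) x12 lowest_subset by blast
    let ?W = "D \<union> (\<lambda>(d, e). d + e) ` (D \<times> W)"
    have "\<exists>y\<in>?W. \<exists>v'\<in>V. 0 < u \<bullet> real_vec y \<and> linked E ?W (q, x) (shift v' y)" if x: "(q, x) \<in> V" for x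
    proof -
      have d: "x - x1 \<in> D" "0 \<le> u \<bullet> real_vec (x - x1)"
        using lowest_le[OF x12(2) x] x x12(2) lowest_subset[of u] DI[of q x x1] by (auto simp: inner_diff_right)
      have "linked E ?W (q, x) (shift (q'', x2) (x - x1))"
        using linked_edge[OF x12(1), of "x - x1" ?W] d by (metis UnI1 swap)
      also have "linked E ?W \<dots> (shift (shift v' y) (x - x1))"
        using y(4) by (rule linked_shift) (use d in \<open>auto simp: add.commute intro!: image_eqI[of _ _ "(x - x1, z)" for z]\<close>)
      finally (linked_trans) have "linked E ?W (q, x) (shift v' ((x - x1) + y))"
        by (simp add: add.commute)
      moreover have "(x - x1) + y \<in> ?W" using d y by force
      moreover have "0 < u \<bullet> real_vec ((x - x1) + y)"
        using d y by (simp add: inner_add_right inner_diff_right)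
      ultimately show ?thesis using y(2) by blast
    qed
    moreover have "finite ?W" using \<open>finite D\<close> W by simp
    moreover have "?W \<subseteq> C" using DC W(1) by (auto intro!: add)
    ultimately show ?case by blast
  qed
qed

end

section \<open>Moving inwards from a polytope boundary\<close>

text \<open>
  The value at \<open>h0\<close> lies in the slot \<open>[0, G)\<close>, so the other elements of \<open>H\<close> are too few to meet
  all of the next \<open>card H\<close> slots of length \<open>G\<close>.
\<close>
lemma slack_gap:
  fixes s :: "'h \<Rightarrow> real"
  assumes "finite H" "h0 \<in> H" "0 \<le> s h0" "s h0 < G" "0 < G"
  obtains k :: nat where "1 \<le> k" "k \<le> card H"
    "\<And>h. h \<in> H \<Longrightarrow> s h < real k * G \<or> real (Suc k) * G \<le> s h"
proof -
  define f where "f h = nat \<lfloor>s h / G\<rfloor>" for h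
  have "f h0 = 0" using assms by (simp add: f_def floor_eq_iff)
  have "card (f ` (H - {h0})) < card {1..card H}"
    using assms(1,2) card_image_le[of "H - {h0}" f] card_gt_0_iff[of H] by (auto intro: order.strict_trans1)
  then have "\<not> {1..card H} \<subseteq> f ` (H - {h0})"
    using assms(1) card_mono[of "f ` (H - {h0})"] by (meson finite_Diff finite_imageI leD)
  then obtain k where k: "1 \<le> k" "k \<le> card H" "k \<notin> f ` (H - {h0})"
    by (metis atLeastAtMost_iff subsetI)
  have "s h < real k * G \<or> real (Suc k) * G \<le> s h" if "h \<in> H" for h
  proof (rule ccontr)
    assume "\<not> ?thesis"
    then have "real k \<le> s h / G" "s h / G < real k + 1"
      using assms(5) by (auto simp: field_simps)
    then have "f h = k" unfolding f_def by linarith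
    moreover from this have "h \<noteq> h0" using \<open>f h0 = 0\<close> k by auto
    ultimately show False using k that by auto
  qed
  then show thesis using that k by blast
qed

text \<open>
  Some element of \<open>I\<close> gains at least \<open>\<epsilon> / card H\<close>, and the resulting decrease of its summand
  outweighs the losses outside \<open>I\<close>, whose summands stay at most \<open>exp (M - G)\<close> times those of \<open>I\<close>.
\<close>
lemma exp_potential_decreases:
  fixes s s' :: "'h \<Rightarrow> real"
  assumes H: "finite H" "I \<subseteq> H"
    and near: "\<And>h. h \<in> I \<Longrightarrow> s h \<le> \<theta>" "\<And>h. h \<in> I \<Longrightarrow> s h \<le> s' h"
    and far: "\<And>h. h \<in> H - I \<Longrightarrow> \<theta> + G \<le> s h" "\<And>h. h \<in> H - I \<Longrightarrow> s h - M \<le> s' h"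
    and gain: "(\<Sum>h\<in>I. s h) + \<epsilon> \<le> (\<Sum>h\<in>I. s' h)" and \<epsilon>: "0 < \<epsilon>"
    and G: "real (card H) * exp (M - G) < 1 - exp (- \<epsilon> / real (card H))"
  shows "(\<Sum>h\<in>H. exp (- s' h)) < (\<Sum>h\<in>H. exp (- s h))"
proof -
  have fin: "finite I" "finite (H - I)" using H finite_subset by auto
  have "\<exists>h\<in>I. \<epsilon> / card H \<le> s' h - s h"
  proof (rule ccontr)
    assume "\<not> ?thesis"
    moreover have "I \<noteq> {}" using gain \<epsilon> by auto
    ultimately have "(\<Sum>h\<in>I. s' h - s h) < (\<Sum>h\<in>I. \<epsilon> / card H)"
      using fin by (intro sum_strict_mono) auto
    also have "\<dots> = \<epsilon> * (card I / card H)" by simp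
    also have "\<dots> \<le> \<epsilon>"
      using card_mono[OF H] \<epsilon> by (intro mult_left_le) (auto simp: divide_le_eq)
    finally show False using gain by (simp add: sum_subtractf)
  qed
  then obtain h0 where h0: "h0 \<in> I" "\<epsilon> / card H \<le> s' h0 - s h0" by blast
  have "(\<Sum>h\<in>H - I. exp (- s' h)) \<le> (\<Sum>h\<in>H - I. exp (M - G) * exp (- \<theta>))"
    using far by (intro sum_mono) (fastforce simp flip: exp_add)
  also have "\<dots> \<le> real (card H) * exp (M - G) * exp (- \<theta>)"
    using card_mono[of H "H - I"] H(1) by (simp add: mult.assoc mult_right_mono)
  also have "\<dots> < (1 - exp (- \<epsilon> / card H)) * exp (- \<theta>)"
    using G by simp
  also have "\<dots> \<le> (1 - exp (- \<epsilon> / card H)) * exp (- s h0)"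
    using near(1)[OF h0(1)] \<epsilon> by (intro mult_left_mono) auto
  also have "\<dots> = exp (- s h0) - exp (- (s h0 + \<epsilon> / card H))"
    by (simp add: algebra_simps exp_diff exp_minus divide_inverse exp_add)
  also have "\<dots> \<le> exp (- s h0) - exp (- s' h0)"
    using h0 by simp
  also have "\<dots> \<le> (\<Sum>h\<in>I. exp (- s h) - exp (- s' h))"
    using h0 near(2) fin by (intro member_le_sum[of h0 I "\<lambda>h. exp (- s h) - exp (- s' h)"]) auto
  finally have "(\<Sum>h\<in>H - I. exp (- s' h)) + (\<Sum>h\<in>I. exp (- s' h)) < (\<Sum>h\<in>I. exp (- s h))"
    by (simp add: sum_subtractf)
  also have "\<dots> \<le> (\<Sum>h\<in>H. exp (- s h))"
    using H by (intro sum_mono2) auto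
  finally show ?thesis
    using sum.subset_diff[OF H(2,1), of "\<lambda>h. exp (- s' h)"] by simp
qed

lemma finite_pos_lower_bound:
  fixes f :: "'a \<Rightarrow> real"
  assumes "finite A"
  shows "\<exists>\<epsilon>>0. \<forall>x\<in>A. 0 < f x \<longrightarrow> \<epsilon> \<le> f x"
proof -
  let ?P = "{x \<in> A. 0 < f x}"
  have "0 < Min (insert 1 (f ` ?P))" using assms by (subst Min_gr_iff) auto
  moreover have "Min (insert 1 (f ` ?P)) \<le> f x" if "x \<in> ?P" for x
    using assms that by (intro Min_le) auto
  ultimately show ?thesis by blast
qed

lemma finite_abs_bound:
  fixes f :: "'a \<Rightarrow> real"
  assumes "finite A"
  shows "\<exists>M\<ge>0. \<forall>x\<in>A. \<bar>f x\<bar> \<le> M"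
proof -
  have "\<bar>f x\<bar> \<le> (\<Sum>x\<in>A. \<bar>f x\<bar>)" if "x \<in> A" for x
    using assms that by (intro member_le_sum) auto
  moreover have "0 \<le> (\<Sum>x\<in>A. \<bar>f x\<bar>)" by (simp add: sum_nonneg)
  ultimately show ?thesis by blast
qed

definition slack :: "real \<Rightarrow> int ^ 'n::finite \<Rightarrow> (real ^ 'n) \<times> real \<Rightarrow> real" where
  "slack r z h = r * snd h + fst h \<bullet> real_vec z"

lemma slack_add: "slack r (z + y) h = slack r z h + fst h \<bullet> real_vec y"
  by (simp add: slack_def inner_add_right)

text \<open>
  Facets are pairs \<open>(u, b)\<close> of an inner normal and an offset. In a coherent set no element of
  \<open>D\<close> points outwards at one facet and inwards at another, so that the sum of the normals
  is nonnegative at an element of \<open>D\<close> only if each of them is.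
\<close>
definition coherent :: "'a::real_inner set \<Rightarrow> ('a \<times> real) set \<Rightarrow> bool" where
  "coherent D I \<longleftrightarrow> (\<forall>h\<in>I. \<forall>h'\<in>I. \<forall>d\<in>D. \<not> (fst h \<bullet> d < 0 \<and> 0 < fst h' \<bullet> d))"

lemma coherent_inner:
  assumes "coherent D I" "finite I" "d \<in> D" "0 \<le> (\<Sum>h\<in>I. fst h) \<bullet> d" "h \<in> I"
  shows "0 \<le> fst h \<bullet> d"
proof (rule ccontr)
  assume neg: "\<not> ?thesis"
  then have "\<forall>h'\<in>I. fst h' \<bullet> d \<le> 0" using assms unfolding coherent_def by force
  then have "(\<Sum>h\<in>I. fst h \<bullet> d) < (\<Sum>h\<in>I. 0)"
    using neg assms by (intro sum_strict_mono_ex1) (auto simp: not_le)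
  then show False using assms(4) by (simp add: inner_sum_left)
qed

lemma coherent_sum_nonzero:
  assumes "coherent D I" "finite I" "h \<in> I" "d \<in> D" "fst h \<bullet> d \<noteq> 0"
  shows "(\<Sum>h\<in>I. fst h) \<noteq> 0"
proof
  assume 0: "(\<Sum>h\<in>I. fst h) = 0"
  then have "(\<Sum>h\<in>I. fst h \<bullet> d) = 0" by (simp flip: inner_sum_left)
  moreover have "\<forall>h\<in>I. 0 \<le> fst h \<bullet> d" using coherent_inner[OF assms(1,2,4)] 0 by simp
  ultimately show False using assms(2,3,5) by (simp add: sum_nonneg_eq_0_iff)
qed

lemma exp_below:
  fixes c \<delta> :: real
  assumes "0 < \<delta>" "0 < c"
  obtains t where "0 \<le> t" "c * exp (- t) < \<delta>"
proof
  let ?t = "max 0 (1 - ln (\<delta> / c))"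
  show "0 \<le> ?t" by simp
  have "exp (- ?t) < exp (ln (\<delta> / c))" by simp
  also have "\<dots> = \<delta> / c" using assms by simp
  finally show "c * exp (- ?t) < \<delta>" using assms by (simp add: field_simps)
qed

context periodic_graph
begin

text \<open>Paths are finite, so finitely many of them use only finitely many translations.\<close>
lemma uniform_neighbourhood:
  assumes "finite B"
  obtains W where "finite W" "\<And>v w y. v \<in> V \<Longrightarrow> w \<in> V \<Longrightarrow> y \<in> B \<Longrightarrow> linked E W v (shift w y)"
proof -
  have "\<exists>W. finite W \<and> linked E W v w" for v w
    using linked_finite_support[OF linked_UNIV] by metis
  then obtain W where W: "\<And>v w. finite (W v w)" "\<And>v w. linked E (W v w) v w"
    by metis
  let ?W = "\<Union>v\<in>V. \<Union>w\<in>V. \<Union>y\<in>B. W v (shift w y)"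
  have "finite ?W" using finite_V assms W by blast
  moreover have "linked E ?W v (shift w y)" if "v \<in> V" "w \<in> V" "y \<in> B" for v w y
    by (rule linked_mono[OF W(2)]) (use that in blast)
  ultimately show thesis using that by blast
qed

text \<open>
  One finite set \<open>W\<close> serves all coherent sets of facets and all states. The cone of translations that
  decrease no slack in \<open>I\<close> is closed under addition, and coherence makes it contain the
  differences needed by \<open>exists_ascent\<close>.
\<close>
lemma uniform_ascent:
  assumes H: "finite H" "\<forall>h\<in>H. \<exists>d\<in>D. fst h \<bullet> d \<noteq> 0"
    and D: "\<forall>v\<in>V. \<forall>w\<in>V. real_vec (snd v - snd w) \<in> D"
  shows "\<exists>W. finite W \<and> (\<forall>I v. I \<subseteq> H \<longrightarrow> I \<noteq> {} \<longrightarrow> coherent D I \<longrightarrow> v \<in> V \<longrightarrow>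
      (\<exists>y\<in>W. \<exists>w\<in>V. 0 < (\<Sum>h\<in>I. fst h) \<bullet> real_vec y \<and> (\<forall>h\<in>I. 0 \<le> fst h \<bullet> real_vec y)
        \<and> linked E {y \<in> W. \<forall>h\<in>I. 0 \<le> fst h \<bullet> real_vec y} v (shift w y)))"
proof -
  define \<I> where "\<I> = {I. I \<subseteq> H \<and> I \<noteq> {} \<and> coherent D I}"
  define C where "C I = {y :: int ^ 'n. \<forall>h\<in>I. 0 \<le> fst h \<bullet> real_vec y}" for I :: "((real ^ 'n) \<times> real) set"
  have "\<exists>W \<subseteq> C I. finite W \<and> (\<forall>x. (q, x) \<in> V \<longrightarrow>
    (\<exists>y\<in>W. \<exists>w\<in>V. 0 < (\<Sum>h\<in>I. fst h) \<bullet> real_vec y \<and> linked E W (q, x) (shift w y)))"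
    if "I \<in> \<I>" for I q
  proof (rule exists_ascent)
    have I: "I \<subseteq> H" "coherent D I" "finite I" "I \<noteq> {}"
      using that H(1) finite_subset by (auto simp: \<I>_def)
    then show "(\<Sum>h\<in>I. fst h) \<noteq> 0"
      using coherent_sum_nonzero[OF I(2,3)] H(2) by blast
    show "x - x' \<in> C I" if "(p, x) \<in> V" "(p, x') \<in> V"
      "(\<Sum>h\<in>I. fst h) \<bullet> real_vec x' \<le> (\<Sum>h\<in>I. fst h) \<bullet> real_vec x" for p x x'
      using coherent_inner[OF I(2,3) D[rule_format, OF that(1,2)]] that(3) by (simp add: C_def inner_diff_right)
  qed (auto simp: C_def inner_add_right)
  then obtain W where W: "\<And>I q. I \<in> \<I> \<Longrightarrow> W I q \<subseteq> C I" "\<And>I q. I \<in> \<I> \<Longrightarrow> finite (W I q)"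
    "\<And>I q x. I \<in> \<I> \<Longrightarrow> (q, x) \<in> V \<Longrightarrow>
      \<exists>y\<in>W I q. \<exists>w\<in>V. 0 < (\<Sum>h\<in>I. fst h) \<bullet> real_vec y \<and> linked E (W I q) (q, x) (shift w y)"
    by metis
  let ?W = "\<Union>I\<in>\<I>. \<Union>q. W I q"
  have "finite \<I>" using H(1) by (auto simp: \<I>_def)
  then have "finite ?W" using W(2) by auto
  moreover have "\<exists>y\<in>?W. \<exists>w\<in>V. 0 < (\<Sum>h\<in>I. fst h) \<bullet> real_vec y \<and> (\<forall>h\<in>I. 0 \<le> fst h \<bullet> real_vec y)
      \<and> linked E {y \<in> ?W. \<forall>h\<in>I. 0 \<le> fst h \<bullet> real_vec y} v (shift w y)"
    if "I \<subseteq> H" "I \<noteq> {}" "coherent D I" "v \<in> V" for I v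
  proof -
    have I: "I \<in> \<I>" using that by (simp add: \<I>_def)
    obtain q x where v: "v = (q, x)" by (cases v)
    have "(q, x) \<in> V" using that(4) v by simp
    then obtain y w where y: "y \<in> W I q" "w \<in> V" "0 < (\<Sum>h\<in>I. fst h) \<bullet> real_vec y" "linked E (W I q) v (shift w y)"
      using W(3)[OF I] v by blast
    have sub: "W I q \<subseteq> {y \<in> ?W. \<forall>h\<in>I. 0 \<le> fst h \<bullet> real_vec y}"
      using W(1)[OF I, of q] I by (auto simp: C_def)
    show ?thesis using y sub linked_mono[OF y(4) sub] by blast
  qed
  ultimately show ?thesis by (intro exI[of _ ?W] conjI allI impI)
qed

text \<open>
  The constants are chosen in the order \<open>W\<close>, \<open>W'\<close> (translations for the ascent and for steps in
  the interior), then bounds \<open>M\<close>, \<open>M'\<close>, \<open>\<epsilon>\<close>, \<open>\<eta>\<close>, \<open>\<beta>\<close> that depend on them and on the facets, then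
  the depth \<open>G\<close>, and last the scale \<open>r\<close>. Since \<open>W\<close> and \<open>W'\<close> are finite, a translation with
  slack at least \<open>G\<close> at some facet still satisfies the inequality of that facet after a step.
\<close>
theorem connected_union_of_translates:
  obtains Z where "finite Z" "Z \<noteq> {}"
    "\<And>v w z z'. v \<in> V \<Longrightarrow> w \<in> V \<Longrightarrow> z \<in> Z \<Longrightarrow> z' \<in> Z \<Longrightarrow> linked E Z (shift v z) (shift w z')"
proof -
  define D where "D = (\<lambda>(v, w). real_vec (snd v - snd w)) ` (V \<times> V) \<union> Basis"
  have "finite D" using finite_V by (simp add: D_def)
  have span: "\<exists>d\<in>D. u \<bullet> d \<noteq> 0" if "u \<noteq> 0" for u
    using that euclidean_all_zero_iff[of u] unfolding D_def by blast
  have D: "\<forall>v\<in>V. \<forall>w\<in>V. real_vec (snd v - snd w) \<in> D"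
    unfolding D_def by (auto simp del: real_vec_simps)
  obtain H where H: "finite H" "zonotope D = {x. \<forall>(u, b)\<in>H. 0 \<le> b + u \<bullet> x}"
    "\<And>u b. (u, b) \<in> H \<Longrightarrow> u \<noteq> 0 \<and> 0 < b \<and> (\<Sum>d\<in>D. \<bar>u \<bullet> d\<bar>) \<le> b"
    using zonotope_halfspaces[OF \<open>finite D\<close> span] by blast
  have bounded: "bounded (zonotope D)"
    using polytope_zonotope[OF \<open>finite D\<close>] polytope_imp_bounded by blast
  have "H \<noteq> {}" using bounded H(2) not_bounded_UNIV by auto
  then have card: "0 < card H" using H(1) by (simp add: card_gt_0_iff)
  have snd_pos: "0 < snd h" if "h \<in> H" for h using H(3)[of "fst h" "snd h"] that by simp

  have regular: "\<forall>h\<in>H. \<exists>d\<in>D. fst h \<bullet> d \<noteq> 0"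
    using span H(3) by (metis prod.collapse)
  obtain W where W: "finite W" "\<forall>I v. I \<subseteq> H \<longrightarrow> I \<noteq> {} \<longrightarrow> coherent D I \<longrightarrow> v \<in> V \<longrightarrow>
      (\<exists>y\<in>W. \<exists>w\<in>V. 0 < (\<Sum>h\<in>I. fst h) \<bullet> real_vec y \<and> (\<forall>h\<in>I. 0 \<le> fst h \<bullet> real_vec y)
        \<and> linked E {y \<in> W. \<forall>h\<in>I. 0 \<le> fst h \<bullet> real_vec y} v (shift w y))"
    using uniform_ascent[OF H(1) regular D] by (elim exE conjE) (rule that)
  have "finite {y :: int ^ 'n. \<forall>j. y $ j \<in> {- 1, 0, 1}}" by (rule finite_vec_range) simp
  then obtain W' where W': "finite W'" "\<And>v w y. v \<in> V \<Longrightarrow> w \<in> V \<Longrightarrow>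
      y \<in> {y :: int ^ 'n. \<forall>j. y $ j \<in> {- 1, 0, 1}} \<Longrightarrow> linked E W' v (shift w y)"
    using uniform_neighbourhood by blast

  have "\<exists>M\<ge>0. \<forall>x\<in>H \<times> (W \<union> W'). \<bar>case x of (h, y) \<Rightarrow> fst h \<bullet> real_vec y\<bar> \<le> M"
    by (rule finite_abs_bound) (use H(1) W(1) W'(1) in blast)
  then obtain M where M: "0 \<le> M" "\<forall>h\<in>H. \<forall>y\<in>W \<union> W'. \<bar>fst h \<bullet> real_vec y\<bar> \<le> M"
    unfolding split_paired_Ball_Sigma prod.case by blast
  obtain M' where M': "0 \<le> M'" "\<And>h. h \<in> H \<Longrightarrow> \<bar>\<Sum>j\<in>UNIV. \<bar>fst h $ j\<bar>\<bar> \<le> M'"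
    using finite_abs_bound[OF H(1), of "\<lambda>h. \<Sum>j\<in>UNIV. \<bar>fst h $ j\<bar>"] by blast
  have "\<exists>\<epsilon>>0. \<forall>x\<in>Pow H \<times> W. 0 < (case x of (I, y) \<Rightarrow> (\<Sum>h\<in>I. fst h) \<bullet> real_vec y)
      \<longrightarrow> \<epsilon> \<le> (case x of (I, y) \<Rightarrow> (\<Sum>h\<in>I. fst h) \<bullet> real_vec y)"
    by (rule finite_pos_lower_bound) (use H(1) W(1) in blast)
  then obtain \<epsilon> where \<epsilon>: "0 < \<epsilon>" "\<forall>I\<in>Pow H. \<forall>y\<in>W.
      0 < (\<Sum>h\<in>I. fst h) \<bullet> real_vec y \<longrightarrow> \<epsilon> \<le> (\<Sum>h\<in>I. fst h) \<bullet> real_vec y"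
    unfolding split_paired_Ball_Sigma prod.case by blast
  have "\<exists>\<eta>>0. \<forall>x\<in>H \<times> D. 0 < (case x of (h, d) \<Rightarrow> \<bar>fst h \<bullet> d\<bar>) \<longrightarrow> \<eta> \<le> (case x of (h, d) \<Rightarrow> \<bar>fst h \<bullet> d\<bar>)"
    by (rule finite_pos_lower_bound) (use H(1) \<open>finite D\<close> in blast)
  then obtain \<eta> where \<eta>: "0 < \<eta>" "\<forall>h\<in>H. \<forall>d\<in>D. 0 < \<bar>fst h \<bullet> d\<bar> \<longrightarrow> \<eta> \<le> \<bar>fst h \<bullet> d\<bar>"
    unfolding split_paired_Ball_Sigma prod.case by blast
  have "\<exists>\<beta>>0. \<forall>h\<in>H. 0 < snd h \<longrightarrow> \<beta> \<le> snd h"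
    by (rule finite_pos_lower_bound) (rule H(1))
  then obtain \<beta> where \<beta>: "0 < \<beta>" "\<And>h. h \<in> H \<Longrightarrow> \<beta> \<le> snd h"
    using snd_pos by blast

  have "0 < 1 - exp (- \<epsilon> / real (card H))" using \<epsilon>(1) card by simp
  then obtain t where t: "0 \<le> t" "real (card H) * exp (- t) < 1 - exp (- \<epsilon> / real (card H))"
    using exp_below card by (metis of_nat_0_less_iff)
  define G where "G = t + 2 * M + M' + 1"
  have G: "0 < G" "2 * M + M' \<le> G" "M \<le> G"
    using t(1) M(1) M'(1) by (auto simp: G_def)
  have "exp (M - G) \<le> exp (- t)" using M(1) M'(1) by (simp add: G_def)
  then have expG: "real (card H) * exp (M - G) < 1 - exp (- \<epsilon> / real (card H))"
    using t(2) by (meson le_less_trans mult_left_mono of_nat_0_le_iff)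
  define r where "r = 1 + 2 * (card H + 1) * G / \<eta> + G / \<beta>"
  have "0 \<le> 2 * (card H + 1) * G / \<eta>" "0 \<le> G / \<beta>" using G(1) \<eta>(1) \<beta>(1) by auto
  then have r: "0 < r" "2 * (card H + 1) * G / \<eta> < r" "G / \<beta> < r" by (auto simp: r_def)
  have r\<eta>: "2 * (card H + 1) * G < r * \<eta>" using r(2) \<eta>(1) by (simp add: field_simps)
  have r\<beta>: "G \<le> r * snd h" if "h \<in> H" for h
  proof -
    have "G \<le> r * \<beta>" using r(3) \<beta>(1) by (simp add: field_simps)
    also have "\<dots> \<le> r * snd h" using r(1) \<beta>(2)[OF that] by simp
    finally show ?thesis .
  qed

  define Z where "Z = {z :: int ^ 'n. \<forall>h\<in>H. 0 \<le> slack r z h}"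
  have zonotope: "(1 / r) *\<^sub>R real_vec z \<in> zonotope D" if "z \<in> Z" for z
  proof -
    have "0 \<le> b + u \<bullet> ((1 / r) *\<^sub>R real_vec z)" if "(u, b) \<in> H" for u b
    proof -
      have "0 \<le> r * b + u \<bullet> real_vec z" using that \<open>z \<in> Z\<close> by (auto simp: Z_def slack_def)
      then show ?thesis using r(1) by (simp add: field_simps)
    qed
    then show ?thesis unfolding H(2) by auto
  qed
  have "real_vec ` Z \<subseteq> (*\<^sub>R) r ` zonotope D"
  proof
    fix x assume "x \<in> real_vec ` Z"
    then obtain z where z: "z \<in> Z" "x = real_vec z" by blast
    then have "x = r *\<^sub>R ((1 / r) *\<^sub>R real_vec z)" using r(1) by simp
    then show "x \<in> (*\<^sub>R) r ` zonotope D" using zonotope[OF z(1)] by blast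
  qed
  then have "finite Z"
    using bounded_scaling[OF bounded] bounded_subset finite_bounded_lattice by blast
  have "0 \<in> Z" using r(1) snd_pos by (auto simp: Z_def slack_def less_imp_le)

  \<comment> \<open>facets that are close at the same point are coherent, since \<open>r * \<eta>\<close> exceeds every pair of
     slacks that counts as close\<close>
  have opposed: "r * \<eta> \<le> slack r z h + slack r z h'"
    if "z \<in> Z" "h \<in> H" "h' \<in> H" "d \<in> D" "fst h \<bullet> d < 0" "0 < fst h' \<bullet> d" for z h h' d
  proof -
    have "\<eta> \<le> 2 * min \<bar>fst h \<bullet> d\<bar> \<bar>fst h' \<bullet> d\<bar>"
      using \<eta>(1) \<eta>(2)[rule_format, of h d] \<eta>(2)[rule_format, of h' d] that by (simp add: min_def)
    also have "\<dots> \<le> snd h + fst h \<bullet> ((1 / r) *\<^sub>R real_vec z) + (snd h' + fst h' \<bullet> ((1 / r) *\<^sub>R real_vec z))"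
      using H(3)[of "fst h" "snd h"] H(3)[of "fst h'" "snd h'"] that
      by (intro zonotope_opposed_facets[OF \<open>finite D\<close> \<open>d \<in> D\<close> zonotope[OF \<open>z \<in> Z\<close>]]) auto
    finally have "r * \<eta> \<le> r * (snd h + fst h \<bullet> ((1 / r) *\<^sub>R real_vec z) + (snd h' + fst h' \<bullet> ((1 / r) *\<^sub>R real_vec z)))"
      using r(1) by simp
    moreover have "slack r z h = r * (snd h + fst h \<bullet> ((1 / r) *\<^sub>R real_vec z))" for h
      using r(1) by (simp add: slack_def distrib_left)
    ultimately show ?thesis by (simp add: distrib_left)
  qed

  define \<Phi> where "\<Phi> z = (\<Sum>h\<in>H. exp (- slack r z h))" for z
  have descent: "\<exists>z'\<in>Z. \<exists>w\<in>V. linked E Z (shift v z) (shift w z') \<and> \<Phi> z' < \<Phi> z"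
    if z: "z \<in> Z" and v: "v \<in> V" and h0: "h0 \<in> H" "slack r z h0 < G" for z v h0
  proof -
    obtain k :: nat where k: "1 \<le> k" "k \<le> card H"
      "\<And>h. h \<in> H \<Longrightarrow> slack r z h < real k * G \<or> real (Suc k) * G \<le> slack r z h"
      using slack_gap[OF H(1) h0(1), of "slack r z" G] z h0 G(1) by (auto simp: Z_def)
    define I where "I = {h \<in> H. slack r z h < real k * G}"
    have "G \<le> real k * G" using k(1) G(1) by simp
    then have "h0 \<in> I" using h0 by (simp add: I_def)
    then have "I \<noteq> {}" by blast
    have "I \<subseteq> H" by (simp add: I_def)
    have far: "real k * G + G \<le> slack r z h" if "h \<in> H - I" for h
      using k(3)[of h] that by (auto simp: I_def algebra_simps)
    have "coherent D I"
      unfolding coherent_def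
    proof (intro ballI notI)
      fix h h' d assume hd: "h \<in> I" "h' \<in> I" "d \<in> D" "fst h \<bullet> d < 0 \<and> 0 < fst h' \<bullet> d"
      then have "r * \<eta> \<le> slack r z h + slack r z h'" using opposed[OF z] by (auto simp: I_def)
      also have "\<dots> \<le> 2 * (real k * G)" using hd by (auto simp: I_def)
      also have "\<dots> \<le> 2 * (card H + 1) * G" using k(2) G(1) by simp
      finally show False using r\<eta> by simp
    qed
    then obtain y w where y: "y \<in> W" "w \<in> V" "0 < (\<Sum>h\<in>I. fst h) \<bullet> real_vec y"
      "\<forall>h\<in>I. 0 \<le> fst h \<bullet> real_vec y"
      "linked E {y \<in> W. \<forall>h\<in>I. 0 \<le> fst h \<bullet> real_vec y} v (shift w y)"
      using W(2)[rule_format, OF \<open>I \<subseteq> H\<close> \<open>I \<noteq> {}\<close> _ v] by blast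
    have inside: "e + z \<in> Z" if e: "e \<in> W" "\<forall>h\<in>I. 0 \<le> fst h \<bullet> real_vec e" for e
    proof -
      have "0 \<le> slack r (z + e) h" if h: "h \<in> H" for h
      proof (cases "h \<in> I")
        case True
        then show ?thesis using e(2) z h by (simp add: slack_add Z_def)
      next
        case False
        then have "real k * G + G \<le> slack r z h" "\<bar>fst h \<bullet> real_vec e\<bar> \<le> M"
          using far[of h] M(2)[rule_format, of h e] h e(1) by auto
        then show ?thesis
          using G \<open>G \<le> real k * G\<close> unfolding slack_add by linarith
      qed
      then show ?thesis by (simp add: Z_def add.commute)
    qed
    have "linked E Z (shift v z) (shift (shift w y) z)"
      using y(5) by (rule linked_shift) (use inside in auto)
    moreover have "\<Phi> (y + z) < \<Phi> z"
      unfolding \<Phi>_def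
    proof (rule exp_potential_decreases[OF H(1) \<open>I \<subseteq> H\<close>, where M = M and G = G and \<theta> = "real k * G" and \<epsilon> = \<epsilon>])
      show "(\<Sum>h\<in>I. slack r z h) + \<epsilon> \<le> (\<Sum>h\<in>I. slack r (y + z) h)"
        using \<epsilon>(2)[rule_format, of I y] \<open>I \<subseteq> H\<close> y(1,3)
        by (simp add: add.commute[of y] slack_add sum.distrib inner_sum_left)
      show "slack r z h - M \<le> slack r (y + z) h" if "h \<in> H - I" for h
        using M(2)[rule_format, of h y] y(1) that by (simp add: add.commute[of y] slack_add abs_le_iff)
      show "slack r z h \<le> slack r (y + z) h" if "h \<in> I" for h
        using y(4) that by (simp add: add.commute[of y] slack_add)
    qed (use far expG \<epsilon>(1) in \<open>auto simp: I_def\<close>)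
    ultimately show ?thesis using inside[OF y(1,4)] y(2) by auto
  qed

  \<comment> \<open>deep translations are linked to \<open>0\<close> along a rounded segment, on which the slack is at least
     \<open>G - M'\<close> by convexity\<close>
  have core: "linked E Z v (shift w z)"
    if v: "v \<in> V" and w: "w \<in> V" and deep: "\<And>h. h \<in> H \<Longrightarrow> G \<le> slack r z h" for v w z
  proof -
    define N where "N = Suc (nat (\<Sum>j\<in>UNIV. \<bar>z $ j\<bar>))"
    let ?p = "lattice_segment z N"
    have N: "0 < N" by (simp add: N_def)
    have zN: "\<bar>z $ j\<bar> \<le> int N" for j
    proof -
      have "\<bar>z $ j\<bar> \<le> (\<Sum>j\<in>UNIV. \<bar>z $ j\<bar>)" by (rule member_le_sum) auto
      then show ?thesis by (simp add: N_def)
    qed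
    have slack: "G - M' \<le> slack r (?p k) h" if "k \<le> N" "h \<in> H" for k h
    proof -
      let ?t = "real k / real N"
      have t: "0 \<le> ?t" "?t \<le> 1" using that N by auto
      have "G = (1 - ?t) * G + ?t * G" by (simp add: algebra_simps)
      also have "\<dots> \<le> (1 - ?t) * (r * snd h) + ?t * slack r z h"
        using t r\<beta>[OF that(2)] deep[OF that(2)] by (intro add_mono mult_left_mono) auto
      also have "\<dots> = r * snd h + ?t * (fst h \<bullet> real_vec z)"
        by (simp add: slack_def algebra_simps)
      also have "\<dots> \<le> slack r (?p k) h + M'"
        using lattice_segment_inner[OF N, of "fst h" z k] M'(2)[OF that(2)]
        unfolding slack_def by linarith
      finally show ?thesis by simp
    qed
    have near: "y + ?p k \<in> Z" if "k \<le> N" "y \<in> W'" for k y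
    proof -
      have "0 \<le> slack r (?p k + y) h" if "h \<in> H" for h
        using slack[OF \<open>k \<le> N\<close> that] M(2)[rule_format, OF that, of y] \<open>y \<in> W'\<close> G M(1)
        by (simp add: slack_add abs_le_iff)
      then show ?thesis by (simp add: Z_def add.commute)
    qed
    have "\<forall>w\<in>V. linked E Z v (shift w (?p k))" if "k \<le> N" for k
      using that
    proof (induction k)
      case 0
      have "linked E Z (shift v (?p 0)) (shift (shift w 0) (?p 0))" if "w \<in> V" for w
        by (rule linked_shift[where Z = W']) (use W'(2)[OF v that, of 0] near[of 0] in auto)
      then show ?case by (simp add: lattice_segment_ends)
    next
      case (Suc k)
      show ?case
      proof
        fix w assume w: "w \<in> V"
        have "linked E Z v (shift v (?p k))" using Suc v by simp
        moreover have "linked E W' v (shift w (?p (Suc k) - ?p k))"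
          using lattice_segment_step[OF N zN] by (intro W'(2)[OF v w]) simp
        then have "linked E Z (shift v (?p k)) (shift (shift w (?p (Suc k) - ?p k)) (?p k))"
          by (rule linked_shift) (use near Suc in simp)
        ultimately show "linked E Z v (shift w (?p (Suc k)))"
          by (simp add: linked_trans)
      qed
    qed
    from this[of N] show ?thesis using w N by (simp add: lattice_segment_ends)
  qed

  have to_core: "linked E Z (shift v z) v0" if v: "v \<in> V" and z: "z \<in> Z" and v0: "v0 \<in> V" for v z v0
  proof -
    let ?T = "{z' \<in> Z. \<exists>w\<in>V. linked E Z (shift v z) (shift w z')}"
    have "z \<in> ?T" using v z linked_refl[of E Z "shift v z"] by blast
    moreover have "finite ?T" using \<open>finite Z\<close> by simp
    ultimately obtain z' where z': "z' \<in> ?T" "\<And>y. y \<in> ?T \<Longrightarrow> \<Phi> z' \<le> \<Phi> y"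
      using ex_is_arg_min_if_finite[of ?T \<Phi>] unfolding is_arg_min_linorder by blast
    then obtain w where w: "w \<in> V" "linked E Z (shift v z) (shift w z')" by blast
    have "G \<le> slack r z' h" if "h \<in> H" for h
    proof (rule ccontr)
      assume "\<not> ?thesis"
      then have "slack r z' h < G" by simp
      with descent[OF _ w(1) \<open>h \<in> H\<close>, of z'] obtain y w'
        where y: "y \<in> Z" "w' \<in> V" "linked E Z (shift w z') (shift w' y)" "\<Phi> y < \<Phi> z'"
        using z' by auto
      have "linked E Z (shift v z) (shift w' y)" by (rule linked_trans[OF w(2) y(3)])
      then have "y \<in> ?T" using y(1,2) by blast
      then show False using z'(2) y(4) by (simp add: not_le[symmetric])
    qed
    then have "linked E Z v0 (shift w z')" using core v0 w(1) by blast
    then show ?thesis using w(2) by (blast intro: linked_sym linked_trans)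
  qed
  obtain v0 where "v0 \<in> V" using states by blast
  then show thesis
    using that[OF \<open>finite Z\<close>] \<open>0 \<in> Z\<close> to_core linked_sym linked_trans by blast
qed

end

section \<open>Automaton graphs\<close>

definition lattice_point :: "'s::finite \<times> (int ^ 'n::finite) \<Rightarrow> ('s, 'n) lattice" where
  "lattice_point v = (axis (fst v) 1, snd v)"

lemma inj_lattice_point: "inj lattice_point"
  by (rule injI) (auto simp: lattice_point_def axis_eq_axis prod_eq_iff)

lemma lattice_point_shift: "lattice_point (shift v z) = lattice_point v + (0, z)"
  by (cases v) (simp add: lattice_point_def)

lemma Lambda_eq_range: "(Lambda :: ('s::finite, 'n::finite) lattice set) = range lattice_point"
proof (intro subset_antisym subsetI)
  fix v :: "('s::finite, 'n::finite) lattice"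
  assume "v \<in> Lambda"
  then obtain q where "v = lattice_point (q, snd v)"
    by (auto simp: Lambda_def Lambda_at_def lattice_point_def)
  then show "v \<in> range lattice_point" by (rule range_eqI)
next
  fix v :: "('s::finite, 'n::finite) lattice"
  assume "v \<in> range lattice_point"
  then show "v \<in> Lambda" by (auto simp: Lambda_def Lambda_at_def lattice_point_def)
qed

lemma inner_to_real_lattice_point: "((\<chi> q. \<beta> q), u) \<bullet> to_real (lattice_point v) = affine_fun \<beta> u v"
proof -
  have "to_real (lattice_point v) = (axis (fst v) 1, real_vec (snd v))"
    by (simp add: to_real_def lattice_point_def vec_eq_iff axis_def)
  then show ?thesis by (simp add: affine_fun_def inner_prod_def inner_axis)
qed

text \<open>A functional that is not constant on \<open>C\<close> takes its minimum outside the relative interior.\<close>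
lemma strict_face_minimum:
  fixes C :: "'a::euclidean_space set"
  assumes "convex C" "\<And>x. x \<in> C \<Longrightarrow> m \<le> a \<bullet> x" "x0 \<in> C" "a \<bullet> x0 = m" "x1 \<in> C" "m < a \<bullet> x1"
  shows "strict_face (C \<inter> {x. a \<bullet> x \<le> m}) C"
proof -
  have eq: "C \<inter> {x. a \<bullet> x \<le> m} = C \<inter> {x. a \<bullet> x = m}" using assms(2) by force
  have "(C \<inter> {x. a \<bullet> x = m}) face_of C"
    by (rule face_of_Int_supporting_hyperplane_ge[OF assms(1,2)])
  moreover have ne: "C \<inter> {x. a \<bullet> x = m} \<noteq> C" using assms(5,6) by auto
  ultimately have "C \<inter> {x. a \<bullet> x = m} \<inter> rel_interior C = {}"
    by (rule face_of_disjoint_rel_interior)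
  moreover have "rel_interior C \<subseteq> C" by (rule rel_interior_subset)
  moreover have "a \<noteq> 0" using assms(4,6) by auto
  ultimately have "face (C \<inter> {x. a \<bullet> x \<le> m}) C"
    unfolding face_def by blast
  then show ?thesis unfolding strict_face_def using assms(3,4) ne eq by auto
qed

lemma snd_semidirect_mult: "snd (g \<otimes>\<^bsub>semidirect smul\<^esub> h) = snd g + snd h"
  by (simp add: semidirect_def case_prod_beta)

lemma snd_semidirect_inv:
  assumes "module smul"
  shows "snd (inv\<^bsub>semidirect smul\<^esub> g) = - snd g"
proof -
  interpret group "semidirect smul" by (rule group_semidirect[OF assms])
  have "g \<otimes>\<^bsub>semidirect smul\<^esub> inv\<^bsub>semidirect smul\<^esub> g = \<one>\<^bsub>semidirect smul\<^esub>"
    by (rule r_inv) (simp add: semidirect_def)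
  then have "snd g + snd (inv\<^bsub>semidirect smul\<^esub> g) = snd (\<one>\<^bsub>semidirect smul\<^esub>)"
    by (metis snd_semidirect_mult)
  then show ?thesis by (simp add: semidirect_def eq_neg_iff_add_eq_0 add.commute)
qed

lemma linked_aut_path:
  assumes "\<And>k z. linked E UNIV (origin B k, z) (destination B k, z + snd (ev B k))"
    and "aut_path B p"
  shows "linked E UNIV (origin B (hd p), z) (destination B (last p), z + snd (ev_path (semidirect smul) B p))"
  using assms(2)
proof (induction p arbitrary: z)
  case (Cons k p)
  show ?case
  proof (cases "p = []")
    case True
    then show ?thesis
      using assms(1)[of k z] by (simp add: ev_path_def snd_semidirect_mult) (simp add: semidirect_def)
  next
    case False
    then have "aut_path B p" "destination B k = origin B (hd p)"
      using Cons.prems by (auto simp: aut_path_def successively_Cons)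
    then have "linked E UNIV (destination B k, z + snd (ev B k))
        (destination B (last p), z + snd (ev B k) + snd (ev_path (semidirect smul) B p))"
      using Cons.IH by metis
    then show ?thesis
      using linked_trans[OF assms(1)[of k z]] False
      by (simp add: ev_path_def snd_semidirect_mult add.assoc)
  qed
qed (simp add: aut_path_def)

text \<open>
  Primitivity links the initial state at \<open>0\<close> to the initial state at every position, and
  a prefix of an accepting run leads from the initial state to any other state; periodicity then
  corrects the position.
\<close>
lemma linked_everywhere:
  assumes "module smul" "trim A" "primitive smul A"
    and step: "\<And>l z. linked E UNIV (origin A l, z) (destination A l, z + snd (ev A l))"
  shows "linked E UNIV v w"
proof -
  have pm: "linked E UNIV (origin (pm_automaton (semidirect smul) A) k, z)
      (destination (pm_automaton (semidirect smul) A) k, z + snd (ev (pm_automaton (semidirect smul) A) k))" for k z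
  proof (cases k)
    case (Inl l)
    then show ?thesis using step[of l z] by (simp add: pm_automaton_def)
  next
    case (Inr l)
    then show ?thesis
      using step[of l "z - snd (ev A l)", THEN linked_sym]
      by (simp add: pm_automaton_def snd_semidirect_inv[OF assms(1)])
  qed
  have loop: "linked E UNIV (initial A, 0) (initial A, x)" for x
  proof -
    have "x \<in> snd ` ev_automaton (semidirect smul) (pm_automaton (semidirect smul) A)"
      using assms(3) by (simp add: primitive_def)
    then obtain p where p: "accepting_run (pm_automaton (semidirect smul) A) p"
      "x = snd (ev_path (semidirect smul) (pm_automaton (semidirect smul) A) p)"
      by (auto simp: ev_automaton_def)
    then have "aut_path (pm_automaton (semidirect smul) A) p"
      "origin (pm_automaton (semidirect smul) A) (hd p) = initial A"
      "destination (pm_automaton (semidirect smul) A) (last p) = initial A"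
      by (auto simp: accepting_run_def pm_automaton_def)
    then show ?thesis using linked_aut_path[OF pm, of p 0 smul] p(2) by simp
  qed
  have state: "\<exists>y. linked E UNIV (initial A, 0) (q, y)" for q
  proof -
    obtain l where l: "origin A l = q" using assms(2) by (auto simp: trim_def)
    obtain p where p: "accepting_run A p" "l \<in> set p" using assms(2) by (auto simp: trim_def)
    then obtain xs ys where xs: "p = xs @ l # ys" by (meson split_list)
    show ?thesis
    proof (cases "xs = []")
      case True
      then have "q = initial A" using p xs l by (simp add: accepting_run_def)
      then show ?thesis using linked_refl by blast
    next
      case False
      then have "aut_path A xs" "origin A (hd xs) = initial A" "destination A (last xs) = q"
        using p(1) xs l by (auto simp: accepting_run_def aut_path_def successively_append_iff)
      then show ?thesis using linked_aut_path[OF step, of xs 0] by metis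
    qed
  qed
  have "linked E UNIV (initial A, 0) w" for w
  proof (cases w)
    case (Pair q x)
    obtain y where y: "linked E UNIV (initial A, 0) (q, y)" using state by blast
    have "linked E UNIV (shift (initial A, 0) (x - y)) (shift (q, y) (x - y))"
      using y by (rule linked_shift) simp
    then show ?thesis using loop[of "x - y"] linked_trans Pair by fastforce
  qed
  then show ?thesis using linked_sym linked_trans by metis
qed

text \<open>
  Being full-image turns every transition into an edge of \<open>\<Gamma>\<close>, hence by translation into an
  edge at every position.
\<close>
lemma periodic_graph_of_automaton_graph:
  fixes \<Gamma> :: "(('s::finite, 'n::finite) lattice, 'e) pre_digraph"
  assumes "module smul" "trim A" "primitive smul A"
    and graph: "automaton_graph A \<Gamma> lab" and "full_image \<Gamma> lab" "face_accessible \<Gamma>"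
  shows "periodic_graph {v. lattice_point v \<in> verts \<Gamma>}
    {(v, w). \<exists>e\<in>arcs \<Gamma>. tail \<Gamma> e = lattice_point v \<and> head \<Gamma> e = lattice_point w}" (is "periodic_graph ?V ?E")
proof -
  interpret fin_digraph \<Gamma> using graph by (simp add: automaton_graph_def)
  have Lambda: "verts \<Gamma> \<subseteq> range lattice_point" using graph by (simp add: automaton_graph_def Lambda_eq_range)
  have labelled: "\<exists>z. ((origin A l, z), (destination A l, z + snd (ev A l))) \<in> ?E" for l
  proof -
    obtain e where e: "e \<in> arcs \<Gamma>" "lab e = l" using assms(5) by (auto simp: full_image_def)
    then obtain z where "tail \<Gamma> e = (axis (origin A l) 1, z)"
      "head \<Gamma> e = (axis (destination A l) 1, z + snd (ev A l))"
      using graph by (auto simp: automaton_graph_def)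
    then show ?thesis using e by (auto simp: lattice_point_def)
  qed
  show ?thesis
  proof
    show "finite ?V" using finite_vimageI[OF finite_verts inj_lattice_point] by (simp add: vimage_def)
    show edges: "?E \<subseteq> ?V \<times> ?V" by (auto dest: tail_in_verts head_in_verts)
    show "\<exists>x. (q, x) \<in> ?V" for q
    proof -
      obtain l where "origin A l = q" using assms(2) by (auto simp: trim_def)
      then show ?thesis using labelled[of l] edges by blast
    qed
    show "linked ?E UNIV v w" for v w
    proof (rule linked_everywhere[OF assms(1-3)])
      fix l z
      obtain z0 where "((origin A l, z0), (destination A l, z0 + snd (ev A l))) \<in> ?E"
        using labelled by blast
      from linked_edge[OF this, of "z - z0" UNIV]
      show "linked ?E UNIV (origin A l, z) (destination A l, z + snd (ev A l))"
        by (simp add: algebra_simps)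
    qed
    fix m \<beta> u
    assume *: "\<forall>v\<in>?V. m \<le> affine_fun \<beta> u v" "\<exists>v\<in>?V. affine_fun \<beta> u v = m" "\<exists>v\<in>?V. m < affine_fun \<beta> u v"
    define a where "a = ((\<chi> q. \<beta> q), u)"
    have a: "a \<bullet> to_real (lattice_point v) = affine_fun \<beta> u v" for v
      by (simp add: a_def inner_to_real_lattice_point)
    define C where "C = convex hull (to_real ` verts \<Gamma>)"
    have sub: "to_real ` verts \<Gamma> \<subseteq> C" by (simp add: C_def hull_subset)
    have "C \<subseteq> {x. m \<le> a \<bullet> x}"
      unfolding C_def
    proof (rule hull_minimal)
      show "to_real ` verts \<Gamma> \<subseteq> {x. m \<le> a \<bullet> x}" using *(1) Lambda a by force
      show "convex {x. m \<le> a \<bullet> x}" using convex_halfspace_ge[of m a] by simp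
    qed
    moreover obtain v0 v1 where "v0 \<in> ?V" "affine_fun \<beta> u v0 = m" "v1 \<in> ?V" "m < affine_fun \<beta> u v1"
      using *(2,3) by blast
    ultimately have "strict_face (C \<inter> {x. a \<bullet> x \<le> m}) C"
      using sub by (intro strict_face_minimum[of C m a "to_real (lattice_point v0)" "to_real (lattice_point v1)"])
        (auto simp: a C_def)
    then obtain e where e: "e \<in> arcs \<Gamma>" "to_real (tail \<Gamma> e) \<in> C \<inter> {x. a \<bullet> x \<le> m}"
      "to_real (head \<Gamma> e) \<in> C - (C \<inter> {x. a \<bullet> x \<le> m})"
      using assms(6) unfolding face_accessible_def Let_def C_def by blast
    obtain v w where vw: "tail \<Gamma> e = lattice_point v" "head \<Gamma> e = lattice_point w"
      using Lambda tail_in_verts[OF e(1)] head_in_verts[OF e(1)] by blast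
    have "(v, w) \<in> ?E" using e(1) vw by blast
    moreover have "affine_fun \<beta> u v = m"
      using e(2) vw(1) *(1)[rule_format, of v] tail_in_verts[OF e(1)] by (intro antisym) (simp_all add: a)
    moreover have "m < affine_fun \<beta> u w"
      using e(3) vw by (auto simp: a)
    ultimately show "\<exists>(v, w)\<in>?E. affine_fun \<beta> u v = m \<and> m < affine_fun \<beta> u w" by blast
  qed
qed

lemma fin_digraph_union_translates:
  assumes "fin_digraph \<Gamma>"
  shows "fin_digraph (indexed_union m (\<lambda>i. translate \<Gamma> (z i)))"
proof -
  interpret fin_digraph \<Gamma> by fact
  show ?thesis
  proof unfold_locales
    fix a assume "a \<in> arcs (indexed_union m (\<lambda>i. translate \<Gamma> (z i)))"
    then obtain i e where "a = (i, e)" "i \<in> {1..m}" "e \<in> arcs \<Gamma>"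
      by (auto simp: indexed_union_def translate_def)
    moreover from this have "tail \<Gamma> e \<in> verts \<Gamma>" "head \<Gamma> e \<in> verts \<Gamma>" by simp_all
    ultimately show "tail (indexed_union m (\<lambda>i. translate \<Gamma> (z i))) a \<in> verts (indexed_union m (\<lambda>i. translate \<Gamma> (z i)))"
      "head (indexed_union m (\<lambda>i. translate \<Gamma> (z i))) a \<in> verts (indexed_union m (\<lambda>i. translate \<Gamma> (z i)))"
      by (auto simp: indexed_union_def translate_def intro!: bexI[of _ i])
  qed (simp_all add: indexed_union_def translate_def)
qed

text \<open>Both degrees at \<open>v\<close> are sums of degrees in \<open>\<Gamma>\<close> at the points \<open>v - (0, z i)\<close>, where a point
  outside \<open>\<Gamma>\<close> contributes \<open>0\<close> to each.\<close>
lemma balanced_union_translates: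
  assumes "fin_digraph \<Gamma>" "degree_symmetric \<Gamma>"
  shows "in_degree (indexed_union m (\<lambda>i. translate \<Gamma> (z i))) v = out_degree (indexed_union m (\<lambda>i. translate \<Gamma> (z i))) v"
    (is "in_degree ?G v = out_degree ?G v")
proof -
  interpret fin_digraph \<Gamma> by fact
  have balanced: "in_degree \<Gamma> w = out_degree \<Gamma> w" for w
  proof (cases "w \<in> verts \<Gamma>")
    case False
    then have "in_arcs \<Gamma> w = {}" "out_arcs \<Gamma> w = {}" by (auto simp: in_arcs_def out_arcs_def)
    then show ?thesis by (simp add: in_degree_def out_degree_def)
  qed (use assms(2) in \<open>simp add: degree_symmetric_def\<close>)
  have "in_arcs ?G v = (SIGMA i:{1..m}. in_arcs \<Gamma> (v - (0, z i)))"
    by (auto simp: in_arcs_def indexed_union_def translate_def eq_diff_eq)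
  then have "in_degree ?G v = (\<Sum>i=1..m. in_degree \<Gamma> (v - (0, z i)))"
    by (simp add: in_degree_def finite_in_arcs)
  moreover have "out_arcs ?G v = (SIGMA i:{1..m}. out_arcs \<Gamma> (v - (0, z i)))"
    by (auto simp: out_arcs_def indexed_union_def translate_def eq_diff_eq)
  then have "out_degree ?G v = (\<Sum>i=1..m. out_degree \<Gamma> (v - (0, z i)))"
    by (simp add: out_degree_def finite_out_arcs)
  ultimately show ?thesis by (simp add: balanced)
qed

lemma connected_union_translates:
  assumes \<Gamma>: "fin_digraph \<Gamma>" "verts \<Gamma> \<subseteq> Lambda" "verts \<Gamma> \<noteq> {}"
    and Z: "z ` {1..m} = Z" "Z \<noteq> {}"
    and linked: "\<And>v w y y'. \<lbrakk>lattice_point v \<in> verts \<Gamma>; lattice_point w \<in> verts \<Gamma>; y \<in> Z; y' \<in> Z\<rbrakk>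
      \<Longrightarrow> linked {(v, w). \<exists>e\<in>arcs \<Gamma>. tail \<Gamma> e = lattice_point v \<and> head \<Gamma> e = lattice_point w} Z (shift v y) (shift w y')"
  shows "Digraph_Component.connected (indexed_union m (\<lambda>i. translate \<Gamma> (z i)))" (is "Digraph_Component.connected ?G")
proof -
  interpret fin_digraph \<Gamma> by fact
  interpret G: fin_digraph ?G by (rule fin_digraph_union_translates[OF \<Gamma>(1)])
  let ?E = "{(v, w). \<exists>e\<in>arcs \<Gamma>. tail \<Gamma> e = lattice_point v \<and> head \<Gamma> e = lattice_point w}"
  let ?R = "parcs (mk_symmetric ?G)"
  have verts_G: "verts ?G = {lattice_point (shift v y) | v y. lattice_point v \<in> verts \<Gamma> \<and> y \<in> Z}"
  proof (intro subset_antisym subsetI)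
    fix u assume "u \<in> verts ?G"
    then obtain i u' where u: "i \<in> {1..m}" "u' \<in> verts \<Gamma>" "u = u' + (0, z i)"
      by (auto simp: indexed_union_def translate_def)
    obtain v where v: "u' = lattice_point v" using u(2) \<Gamma>(2) by (auto simp: Lambda_eq_range)
    have "u = lattice_point (shift v (z i))" "lattice_point v \<in> verts \<Gamma>" "z i \<in> Z"
      using u v Z(1) by (auto simp: lattice_point_shift)
    then show "u \<in> {lattice_point (shift v y) | v y. lattice_point v \<in> verts \<Gamma> \<and> y \<in> Z}"
      by blast
  next
    fix u assume "u \<in> {lattice_point (shift v y) | v y. lattice_point v \<in> verts \<Gamma> \<and> y \<in> Z}"
    then obtain v i where "i \<in> {1..m}" "lattice_point v \<in> verts \<Gamma>" "u = lattice_point v + (0, z i)"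
      unfolding Z(1)[symmetric] lattice_point_shift by blast
    then show "u \<in> verts ?G"
      by (auto simp: indexed_union_def translate_def intro!: bexI[of _ i])
  qed
  have arc: "(lattice_point (shift x y), lattice_point (shift x' y)) \<in> ?R \<and> (lattice_point (shift x' y), lattice_point (shift x y)) \<in> ?R
      \<and> lattice_point (shift x y) \<in> verts ?G \<and> lattice_point (shift x' y) \<in> verts ?G"
    if edge: "(x, x') \<in> ?E" "y \<in> Z" for x x' y
  proof -
    obtain e where e: "e \<in> arcs \<Gamma>" "tail \<Gamma> e = lattice_point x" "head \<Gamma> e = lattice_point x'" using edge(1) by blast
    obtain i where i: "i \<in> {1..m}" "y = z i" using edge(2) Z(1) by blast
    have "(i, e) \<in> arcs ?G" "tail ?G (i, e) = lattice_point (shift x y)" "head ?G (i, e) = lattice_point (shift x' y)"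
      using e i by (auto simp: indexed_union_def translate_def lattice_point_shift)
    then show ?thesis
      using G.tail_in_verts[of "(i, e)"] G.head_in_verts[of "(i, e)"] by (force simp: mk_symmetric_def)
  qed
  have reach: "(lattice_point v, lattice_point w) \<in> rtrancl_on (verts ?G) ?R" if "linked ?E Z v w" "lattice_point v \<in> verts ?G" for v w
    using that(1)
  proof (induction rule: linked_induct)
    case refl
    then show ?case using that(2) by simp
  next
    case (forward x x' y)
    then show ?case using arc[of x x' y] by (blast intro: rtrancl_on_into_rtrancl_on)
  next
    case (backward x x' y)
    then show ?case using arc[of x x' y] by (blast intro: rtrancl_on_into_rtrancl_on)
  qed
  show ?thesis
  proof (rule G.connectedI)
    show "verts ?G \<noteq> {}" using \<Gamma>(2,3) Z(2) unfolding verts_G Lambda_eq_range by blast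
    fix v w assume vw: "v \<in> verts ?G" "w \<in> verts ?G"
    then obtain x y x' y' where "v = lattice_point (shift x y)" "w = lattice_point (shift x' y')"
      "lattice_point x \<in> verts \<Gamma>" "lattice_point x' \<in> verts \<Gamma>" "y \<in> Z" "y' \<in> Z"
      unfolding verts_G by blast
    then have "(v, w) \<in> rtrancl_on (verts ?G) ?R" using reach linked vw(1) by blast
    then show "v \<rightarrow>\<^sup>*\<^bsub>mk_symmetric ?G\<^esub> w"
      by (simp add: reachable_def)
  qed
qed

theorem theorem4p7:
  fixes smul :: "'n::finite laurent \<Rightarrow> 'y::ab_group_add \<Rightarrow> 'y"
    and A :: "('s::finite, 't::finite, 'y \<times> (int ^ 'n)) automaton"
    and \<Gamma> :: "(('s, 'n) lattice, 'e) pre_digraph"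
    and lab :: "'e \<Rightarrow> 't"
  assumes "module smul"
    and "finitely_presented smul"
    and "trim A"
    and "primitive smul A"
    and "automaton_graph A \<Gamma> lab"
    and "full_image \<Gamma> lab"
    and "degree_symmetric \<Gamma>"
    and "face_accessible \<Gamma>"
  shows "\<exists>(m::nat) (z::nat \<Rightarrow> int ^ 'n).
    eulerian (indexed_union m (\<lambda>i. translate \<Gamma> (z i)))"
proof -
  have \<Gamma>: "fin_digraph \<Gamma>" "verts \<Gamma> \<subseteq> Lambda" using assms(5) by (auto simp: automaton_graph_def)
  interpret periodic_graph "{v. lattice_point v \<in> verts \<Gamma>}"
    "{(v, w). \<exists>e\<in>arcs \<Gamma>. tail \<Gamma> e = lattice_point v \<and> head \<Gamma> e = lattice_point w}"
    by (rule periodic_graph_of_automaton_graph[OF assms(1,3-6,8)])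
  obtain Z where Z: "finite Z" "Z \<noteq> {}"
    "\<And>v w y y'. \<lbrakk>lattice_point v \<in> verts \<Gamma>; lattice_point w \<in> verts \<Gamma>; y \<in> Z; y' \<in> Z\<rbrakk>
      \<Longrightarrow> linked {(v, w). \<exists>e\<in>arcs \<Gamma>. tail \<Gamma> e = lattice_point v \<and> head \<Gamma> e = lattice_point w} Z (shift v y) (shift w y')"
    using connected_union_of_translates by auto
  obtain z where "bij_betw z {1..card Z} Z" using ex_bij_betw_nat_finite_1[OF Z(1)] by blast
  then have z: "z ` {1..card Z} = Z" by (simp add: bij_betw_def)
  let ?G = "indexed_union (card Z) (\<lambda>i. translate \<Gamma> (z i))"
  interpret G: fin_digraph ?G by (rule fin_digraph_union_translates[OF \<Gamma>(1)])
  have "verts \<Gamma> \<noteq> {}" using states by blast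
  then have "Digraph_Component.connected ?G"
    by (rule connected_union_translates[OF \<Gamma> _ z Z(2,3)])
  then have "\<exists>u p. G.euler_trail u p u"
    using G.closed_euler1 balanced_union_translates[OF \<Gamma>(1) assms(7)] by blast
  then show ?thesis unfolding eulerian_def by blast
qed

end
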